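(* Let $R$ be a ring with Jacobson radical $J$ and right socle $S_r$. (1) If $R$ is semilocal, then $R$ is right self-injective if and only if $R$ is right small injective. (2) If $R$ is semilocal, then $R$ is right simple injective if and only if $R$ is right simple $J$-injective. (3) If $R$ is semiregular, $I$ is a right ideal of $R$ and $m\ge 1$ is an integer, then $R$ is right $(J,I)$-$m$-injective if and only if $R$ is right $(R,I)$-$m$-injective. In particular (for $R$ semiregular): $R$ is right $(J,S_r)$-$m$-injective if and only if $R$ is right $(R,S_r)$-$m$-injective; $R$ is right $(J,R)$-$m$-injective if and only if $R$ is right $m$-injective; and $R$ is right $F$-injective if and only if $R$ is right $(J,R)$-$k$-injective for all $k\ge 1$. (4) If $R$ is semiregular, then $R$ is right $(J,R)$-$FP$-injective if and only if $R$ is right $FP$-injective.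
   Context: Rings are associative with identity (not necessarily commutative). A right ideal $I$ of $R$ is small if $I+K\neq R$ for every proper right ideal $K$ of $R$. $R$ is right small injective if every right $R$-homomorphism from a small right ideal of $R$ to $R_R$ extends to an $R$-homomorphism $R_R\to R_R$. $R$ is right simple injective (resp. right simple $J$-injective) if every $R$-homomorphism with simple image from a right ideal (resp. small right ideal) of $R$ to $R_R$ extends to an $R$-homomorphism $R_R\to R_R$. For right ideals $I,K$ of $R$ and $m\ge1$, $R$ is right $(I,K)$-$m$-injective if, for every $m$-generated right ideal $U\subseteq I$, every $R$-homomorphism $U_R\to K_R$ extends to an $R$-homomorphism $R_R\to R_R$. $R$ is right $m$-injective (resp. right $F$-injective) if every $R$-homomorphism from an $m$-generated (resp. finitely generated) right ideal of $R$ to $R_R$ extends to $R_R\to R_R$. For a right ideal $I$, $I_n$ denotes the right $R$-module of all $n\times 1$ matrices (columns) over $I$. $R$ is right $(I,K)$-$FP$-injective if, for every $n\ge 1$ and every finitely generated $R$-submodule $N$ of $I_n$, every $R$-homomorphism $N\to K$ extends to an $R$-homomorphism $R_n\to R$. $R$ is right $FP$-injective if it is right $(R,R)$-$FP$-injective. $R$ is semilocal if $R/J$ is semisimple artinian; $R$ is semiregular if $R/J$ is von Neumann regular and idempotents lift modulo $J$. *)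

theory Defs
  imports "HOL-Algebra.QuotRing" "HOL-Library.FuncSet"
begin

text \<open>
  The locale \<open>module\<close> of HOL-Algebra requires a commutative ring acting on the left.  Right modules
  over an arbitrary ring are therefore set up here.  The record extends \<^type>\<open>ring\<close> only so that
  \<^locale>\<open>abelian_group\<close> and \<^locale>\<open>additive_subgroup\<close> apply; the fields \<open>mult\<close> and
  \<open>one\<close> of a module carry no meaning.
\<close>

record ('a, 'm) rmod = "'m ring" +
  ract :: "'m \<Rightarrow> 'a \<Rightarrow> 'm" (infixl "\<cdot>\<index>" 70)

locale right_module = ring R + abelian_group M for R (structure) and M (structure) +
  assumes ract_closed: "\<lbrakk>x \<in> carrier M; a \<in> carrier R\<rbrakk> \<Longrightarrow> x \<cdot>\<^bsub>M\<^esub> a \<in> carrier M"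
    and ract_add_left: "\<lbrakk>x \<in> carrier M; y \<in> carrier M; a \<in> carrier R\<rbrakk>
      \<Longrightarrow> (x \<oplus>\<^bsub>M\<^esub> y) \<cdot>\<^bsub>M\<^esub> a = x \<cdot>\<^bsub>M\<^esub> a \<oplus>\<^bsub>M\<^esub> y \<cdot>\<^bsub>M\<^esub> a"
    and ract_add_right: "\<lbrakk>x \<in> carrier M; a \<in> carrier R; b \<in> carrier R\<rbrakk>
      \<Longrightarrow> x \<cdot>\<^bsub>M\<^esub> (a \<oplus>\<^bsub>R\<^esub> b) = x \<cdot>\<^bsub>M\<^esub> a \<oplus>\<^bsub>M\<^esub> x \<cdot>\<^bsub>M\<^esub> b"
    and ract_mult: "\<lbrakk>x \<in> carrier M; a \<in> carrier R; b \<in> carrier R\<rbrakk>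
      \<Longrightarrow> x \<cdot>\<^bsub>M\<^esub> (a \<otimes>\<^bsub>R\<^esub> b) = (x \<cdot>\<^bsub>M\<^esub> a) \<cdot>\<^bsub>M\<^esub> b"
    and ract_one: "x \<in> carrier M \<Longrightarrow> x \<cdot>\<^bsub>M\<^esub> \<one>\<^bsub>R\<^esub> = x"

definition rsubmodule :: "('a, 'c) ring_scheme \<Rightarrow> ('a, 'm, 'd) rmod_scheme \<Rightarrow> 'm set \<Rightarrow> bool" where
  "rsubmodule R M N \<longleftrightarrow>
     additive_subgroup N M \<and> (\<forall>x\<in>N. \<forall>a\<in>carrier R. x \<cdot>\<^bsub>M\<^esub> a \<in> N)"

definition rspan :: "('a, 'c) ring_scheme \<Rightarrow> ('a, 'm, 'd) rmod_scheme \<Rightarrow> 'm set \<Rightarrow> 'm set" where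
  "rspan R M S = \<Inter>{N. rsubmodule R M N \<and> S \<subseteq> N}"

text \<open>Generators may repeat, so \<open>m\<close>-generated means generated by at most \<open>m\<close> elements.\<close>

definition m_generated ::
  "('a, 'c) ring_scheme \<Rightarrow> ('a, 'm, 'd) rmod_scheme \<Rightarrow> nat \<Rightarrow> 'm set \<Rightarrow> bool" where
  "m_generated R M m N \<longleftrightarrow>
     (\<exists>x :: nat \<Rightarrow> 'm. x ` {..<m} \<subseteq> carrier M \<and> N = rspan R M (x ` {..<m}))"

definition fin_generated ::
  "('a, 'c) ring_scheme \<Rightarrow> ('a, 'm, 'd) rmod_scheme \<Rightarrow> 'm set \<Rightarrow> bool" where
  "fin_generated R M N \<longleftrightarrow> (\<exists>S. finite S \<and> S \<subseteq> carrier M \<and> N = rspan R M S)"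

definition simple_rsubmodule ::
  "('a, 'c) ring_scheme \<Rightarrow> ('a, 'm, 'd) rmod_scheme \<Rightarrow> 'm set \<Rightarrow> bool" where
  "simple_rsubmodule R M N \<longleftrightarrow>
     rsubmodule R M N \<and> N \<noteq> {\<zero>\<^bsub>M\<^esub>} \<and>
     (\<forall>L. rsubmodule R M L \<and> L \<subseteq> N \<longrightarrow> L = {\<zero>\<^bsub>M\<^esub>} \<or> L = N)"

text \<open>Homomorphisms are constrained only on the carrier; a submodule \<open>U\<close> of \<open>M\<close> is regarded as the
  module \<open>M\<lparr>carrier := U\<rparr>\<close>.\<close>

definition rmod_hom ::
  "('a, 'c) ring_scheme \<Rightarrow> ('a, 'm, 'd) rmod_scheme \<Rightarrow> ('a, 'n, 'e) rmod_scheme \<Rightarrow> ('m \<Rightarrow> 'n) set"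
  where
  "rmod_hom R M N = {f \<in> carrier M \<rightarrow> carrier N.
     (\<forall>x\<in>carrier M. \<forall>y\<in>carrier M. f (x \<oplus>\<^bsub>M\<^esub> y) = f x \<oplus>\<^bsub>N\<^esub> f y) \<and>
     (\<forall>x\<in>carrier M. \<forall>a\<in>carrier R. f (x \<cdot>\<^bsub>M\<^esub> a) = f x \<cdot>\<^bsub>N\<^esub> a)}"

definition extends_to ::
  "('a, 'c) ring_scheme \<Rightarrow> ('a, 'm, 'd) rmod_scheme \<Rightarrow> ('a, 'n, 'e) rmod_scheme
    \<Rightarrow> 'm set \<Rightarrow> ('m \<Rightarrow> 'n) \<Rightarrow> bool" where
  "extends_to R M N U f \<longleftrightarrow> (\<exists>g\<in>rmod_hom R M N. \<forall>x\<in>U. g x = f x)"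

definition regular_rmod :: "('a, 'c) ring_scheme \<Rightarrow> ('a, 'a) rmod" where
  "regular_rmod R = \<lparr>carrier = carrier R, mult = mult R, one = \<one>\<^bsub>R\<^esub>,
     zero = \<zero>\<^bsub>R\<^esub>, add = add R, ract = mult R\<rparr>"

text \<open>Columns of length \<open>n\<close> over \<open>R\<close>, indexed by \<open>{..<n}\<close> and \<open>undefined\<close> outside.\<close>

definition column_rmod :: "('a, 'c) ring_scheme \<Rightarrow> nat \<Rightarrow> ('a, nat \<Rightarrow> 'a) rmod" where
  "column_rmod R n = \<lparr>carrier = {..<n} \<rightarrow>\<^sub>E carrier R, mult = undefined, one = undefined,
     zero = (\<lambda>i\<in>{..<n}. \<zero>\<^bsub>R\<^esub>), add = (\<lambda>x y. \<lambda>i\<in>{..<n}. x i \<oplus>\<^bsub>R\<^esub> y i),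
     ract = (\<lambda>x a. \<lambda>i\<in>{..<n}. x i \<otimes>\<^bsub>R\<^esub> a)\<rparr>"

definition right_ideal :: "('a, 'c) ring_scheme \<Rightarrow> 'a set \<Rightarrow> bool" where
  "right_ideal R I \<longleftrightarrow> rsubmodule R (regular_rmod R) I"

definition maximal_right_ideal :: "('a, 'c) ring_scheme \<Rightarrow> 'a set \<Rightarrow> bool" where
  "maximal_right_ideal R I \<longleftrightarrow>
     right_ideal R I \<and> I \<noteq> carrier R \<and>
     (\<forall>K. right_ideal R K \<and> I \<subseteq> K \<longrightarrow> K = I \<or> K = carrier R)"

text \<open>If \<open>R\<close> is the zero ring there are no maximal right ideals and the radical is \<open>carrier R\<close>.\<close>

definition jacobson_radical :: "('a, 'c) ring_scheme \<Rightarrow> 'a set" where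
  "jacobson_radical R = {x \<in> carrier R. \<forall>I. maximal_right_ideal R I \<longrightarrow> x \<in> I}"

text \<open>The sum of all simple right ideals, i.e. the right ideal generated by their union.\<close>

definition right_socle :: "('a, 'c) ring_scheme \<Rightarrow> 'a set" where
  "right_socle R =
     rspan R (regular_rmod R) (\<Union>{I. simple_rsubmodule R (regular_rmod R) I})"

definition right_artinian :: "('a, 'c) ring_scheme \<Rightarrow> bool" where
  "right_artinian R \<longleftrightarrow>
     (\<forall>I :: nat \<Rightarrow> 'a set. (\<forall>n. right_ideal R (I n) \<and> I (Suc n) \<subseteq> I n)
        \<longrightarrow> (\<exists>k. \<forall>n\<ge>k. I n = I k))"

text \<open>The regular right module is a sum of simple submodules, and right ideals satisfy the
  descending chain condition; for unital rings the second condition is implied by the first.\<close>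

definition semisimple_artinian :: "('a, 'c) ring_scheme \<Rightarrow> bool" where
  "semisimple_artinian R \<longleftrightarrow> right_socle R = carrier R \<and> right_artinian R"

definition von_neumann_regular :: "('a, 'c) ring_scheme \<Rightarrow> bool" where
  "von_neumann_regular R \<longleftrightarrow>
     (\<forall>a\<in>carrier R. \<exists>b\<in>carrier R. a = a \<otimes>\<^bsub>R\<^esub> b \<otimes>\<^bsub>R\<^esub> a)"

definition idempotents_lift_modulo :: "('a, 'c) ring_scheme \<Rightarrow> 'a set \<Rightarrow> bool" where
  "idempotents_lift_modulo R I \<longleftrightarrow>
     (\<forall>a\<in>carrier R. a \<otimes>\<^bsub>R\<^esub> a \<ominus>\<^bsub>R\<^esub> a \<in> I \<longrightarrow>
        (\<exists>e\<in>carrier R. e \<otimes>\<^bsub>R\<^esub> e = e \<and> e \<ominus>\<^bsub>R\<^esub> a \<in> I))"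

definition semilocal :: "('a, 'c) ring_scheme \<Rightarrow> bool" where
  "semilocal R \<longleftrightarrow> semisimple_artinian (R Quot jacobson_radical R)"

definition semiregular :: "('a, 'c) ring_scheme \<Rightarrow> bool" where
  "semiregular R \<longleftrightarrow>
     von_neumann_regular (R Quot jacobson_radical R) \<and>
     idempotents_lift_modulo R (jacobson_radical R)"

definition small_right_ideal :: "('a, 'c) ring_scheme \<Rightarrow> 'a set \<Rightarrow> bool" where
  "small_right_ideal R I \<longleftrightarrow>
     right_ideal R I \<and>
     (\<forall>K. right_ideal R K \<and> K \<noteq> carrier R \<longrightarrow> I <+>\<^bsub>R\<^esub> K \<noteq> carrier R)"

text \<open>Injectivity of the module \<open>Q\<close>, tested on all right modules with elements in the type \<open>'m\<close>.\<close>

definition injective_rmod ::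
  "'m itself \<Rightarrow> ('a, 'c) ring_scheme \<Rightarrow> ('a, 'q, 'e) rmod_scheme \<Rightarrow> bool" where
  "injective_rmod (T :: 'm itself) R Q \<longleftrightarrow>
     right_module R Q \<and>
     (\<forall>(B :: ('a, 'm) rmod) A f.
        right_module R B \<and> rsubmodule R B A \<and> f \<in> rmod_hom R (B\<lparr>carrier := A\<rparr>) Q
        \<longrightarrow> extends_to R B Q A f)"

text \<open>
  A formula cannot quantify over types, so the type of the test modules is a parameter.  It is used
  below with \<open>'m = 'a + 'b\<close> for a free type variable \<open>'b\<close>: this type contains a copy of \<open>R\<close> (with a
  smaller type the notion could degenerate), and since \<open>'b\<close> is arbitrary, modules of every size
  are covered.
\<close>

definition right_self_injective :: "'m itself \<Rightarrow> ('a, 'c) ring_scheme \<Rightarrow> bool" where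
  "right_self_injective T R \<longleftrightarrow> injective_rmod T R (regular_rmod R)"

definition right_small_injective :: "('a, 'c) ring_scheme \<Rightarrow> bool" where
  "right_small_injective R \<longleftrightarrow>
     (\<forall>I f. small_right_ideal R I \<and>
        f \<in> rmod_hom R ((regular_rmod R)\<lparr>carrier := I\<rparr>) (regular_rmod R)
        \<longrightarrow> extends_to R (regular_rmod R) (regular_rmod R) I f)"

definition right_simple_injective :: "('a, 'c) ring_scheme \<Rightarrow> bool" where
  "right_simple_injective R \<longleftrightarrow>
     (\<forall>I f. right_ideal R I \<and>
        f \<in> rmod_hom R ((regular_rmod R)\<lparr>carrier := I\<rparr>) (regular_rmod R) \<and>
        simple_rsubmodule R (regular_rmod R) (f ` I)
        \<longrightarrow> extends_to R (regular_rmod R) (regular_rmod R) I f)"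

definition right_simple_J_injective :: "('a, 'c) ring_scheme \<Rightarrow> bool" where
  "right_simple_J_injective R \<longleftrightarrow>
     (\<forall>I f. small_right_ideal R I \<and>
        f \<in> rmod_hom R ((regular_rmod R)\<lparr>carrier := I\<rparr>) (regular_rmod R) \<and>
        simple_rsubmodule R (regular_rmod R) (f ` I)
        \<longrightarrow> extends_to R (regular_rmod R) (regular_rmod R) I f)"

definition right_IK_m_injective ::
  "('a, 'c) ring_scheme \<Rightarrow> 'a set \<Rightarrow> 'a set \<Rightarrow> nat \<Rightarrow> bool" where
  "right_IK_m_injective R I K m \<longleftrightarrow>
     (\<forall>U f. right_ideal R U \<and> U \<subseteq> I \<and> m_generated R (regular_rmod R) m U \<and>
        f \<in> rmod_hom R ((regular_rmod R)\<lparr>carrier := U\<rparr>) ((regular_rmod R)\<lparr>carrier := K\<rparr>)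
        \<longrightarrow> extends_to R (regular_rmod R) (regular_rmod R) U f)"

definition right_m_injective :: "('a, 'c) ring_scheme \<Rightarrow> nat \<Rightarrow> bool" where
  "right_m_injective R m \<longleftrightarrow>
     (\<forall>U f. right_ideal R U \<and> m_generated R (regular_rmod R) m U \<and>
        f \<in> rmod_hom R ((regular_rmod R)\<lparr>carrier := U\<rparr>) (regular_rmod R)
        \<longrightarrow> extends_to R (regular_rmod R) (regular_rmod R) U f)"

definition right_F_injective :: "('a, 'c) ring_scheme \<Rightarrow> bool" where
  "right_F_injective R \<longleftrightarrow>
     (\<forall>U f. right_ideal R U \<and> fin_generated R (regular_rmod R) U \<and>
        f \<in> rmod_hom R ((regular_rmod R)\<lparr>carrier := U\<rparr>) (regular_rmod R)
        \<longrightarrow> extends_to R (regular_rmod R) (regular_rmod R) U f)"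

definition right_IK_FP_injective :: "('a, 'c) ring_scheme \<Rightarrow> 'a set \<Rightarrow> 'a set \<Rightarrow> bool" where
  "right_IK_FP_injective R I K \<longleftrightarrow>
     (\<forall>n\<ge>1. \<forall>N f. rsubmodule R (column_rmod R n) N \<and> N \<subseteq> {..<n} \<rightarrow>\<^sub>E I \<and>
        fin_generated R (column_rmod R n) N \<and>
        f \<in> rmod_hom R ((column_rmod R n)\<lparr>carrier := N\<rparr>) ((regular_rmod R)\<lparr>carrier := K\<rparr>)
        \<longrightarrow> extends_to R (column_rmod R n) (regular_rmod R) N f)"

definition right_FP_injective :: "('a, 'c) ring_scheme \<Rightarrow> bool" where
  "right_FP_injective R \<longleftrightarrow> right_IK_FP_injective R (carrier R) (carrier R)"

end

theory Submission
  imports Defs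
begin

text \<open>
  Suppose that \<open>e \<in> U\<close> is a left unit of the right ideal \<open>U\<close> modulo \<open>J\<close>, i.e. \<open>u - e u \<in> J\<close> for all
  \<open>u \<in> U\<close>, and put \<open>p x = x - e x\<close>.  If the restriction of \<open>f : U \<rightarrow> R\<close> to \<open>p U \<subseteq> U \<inter> J\<close> extends to
  \<open>g : R \<rightarrow> R\<close>, then \<open>x \<mapsto> f e \<cdot> x + g (p x)\<close> extends \<open>f\<close>.  So it is enough to extend homomorphisms defined
  inside \<open>J\<close>, and every right ideal inside \<open>J\<close> is small.  More generally, for a submodule \<open>N\<close> of \<open>M\<close>,
  \<open>\<phi> : M \<rightarrow> R\<close> and \<open>y \<in> N\<close>, take \<open>p x = x - y \<cdot> \<phi> x\<close> and \<open>x \<mapsto> f y \<cdot> \<phi> x + g (p x)\<close>; with \<open>\<phi>\<close> the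
  entries of a column this gives the \<open>FP\<close> case.

  If \<open>R/J\<close> is von Neumann regular, finitely generated right ideals have left units modulo \<open>J\<close>, and
  \<open>p U\<close> needs no more generators than \<open>U\<close>.  If \<open>R/J\<close> is right artinian, every right ideal \<open>U\<close> has one: there
  is a right ideal \<open>K\<close> with \<open>U + K = R\<close> and \<open>U \<inter> K \<subseteq> J\<close>, and \<open>1 = e + k\<close> yields \<open>u - e u = k u \<in> U \<inter> K\<close>.
\<close>

section \<open>Right modules\<close>

abbreviation (in ring) "RR \<equiv> regular_rmod R"

text \<open>The facts inherited from \<open>ring R\<close> and \<open>abelian_group M\<close> have the same names in \<open>right_module\<close>;
  the qualifiers keep them apart.\<close>

locale rmodule = R: ring R + M: right_module R M for R (structure) and M (structure)

lemma rmodule_iff: "rmodule R M \<longleftrightarrow> right_module R M"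
  unfolding rmodule_def using right_module.axioms(1) by blast

lemma rmod_homI:
  assumes "\<And>x. x \<in> carrier M \<Longrightarrow> f x \<in> carrier N"
    and "\<And>x y. x \<in> carrier M \<Longrightarrow> y \<in> carrier M \<Longrightarrow> f (x \<oplus>\<^bsub>M\<^esub> y) = f x \<oplus>\<^bsub>N\<^esub> f y"
    and "\<And>x a. x \<in> carrier M \<Longrightarrow> a \<in> carrier R \<Longrightarrow> f (x \<cdot>\<^bsub>M\<^esub> a) = f x \<cdot>\<^bsub>N\<^esub> a"
  shows "f \<in> rmod_hom R M N"
  using assms by (auto simp: rmod_hom_def)

lemma rmod_hom_closed: "f \<in> rmod_hom R M N \<Longrightarrow> x \<in> carrier M \<Longrightarrow> f x \<in> carrier N"
  and rmod_hom_add: "f \<in> rmod_hom R M N \<Longrightarrow> x \<in> carrier M \<Longrightarrow> y \<in> carrier M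
    \<Longrightarrow> f (x \<oplus>\<^bsub>M\<^esub> y) = f x \<oplus>\<^bsub>N\<^esub> f y"
  and rmod_hom_ract: "f \<in> rmod_hom R M N \<Longrightarrow> x \<in> carrier M \<Longrightarrow> a \<in> carrier R
    \<Longrightarrow> f (x \<cdot>\<^bsub>M\<^esub> a) = f x \<cdot>\<^bsub>N\<^esub> a"
  by (auto simp: rmod_hom_def)

lemma rmod_hom_restrict:
  "f \<in> rmod_hom R (M\<lparr>carrier := N\<rparr>) Q \<Longrightarrow> N' \<subseteq> N \<Longrightarrow> f \<in> rmod_hom R (M\<lparr>carrier := N'\<rparr>) Q"
  by (simp add: rmod_hom_def Pi_iff subset_iff)

lemma rmod_hom_codomain_mono:
  "f \<in> rmod_hom R M (Q\<lparr>carrier := K\<rparr>) \<Longrightarrow> K \<subseteq> carrier Q \<Longrightarrow> f \<in> rmod_hom R M Q"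
  by (auto simp: rmod_hom_def)

lemma regular_rmod_sel [simp]:
  "carrier (regular_rmod R) = carrier R" "zero (regular_rmod R) = zero R"
  "add (regular_rmod R) = add R" "ract (regular_rmod R) = mult R"
  by (simp_all add: regular_rmod_def)

section \<open>Submodules, spans and generating sets\<close>

context rmodule
begin

lemma ract_closed [simp]: "x \<in> carrier M \<Longrightarrow> a \<in> carrier R \<Longrightarrow> x \<cdot>\<^bsub>M\<^esub> a \<in> carrier M"
  by (rule M.ract_closed)

lemma ract_zero_right [simp]:
  assumes "x \<in> carrier M" shows "x \<cdot>\<^bsub>M\<^esub> \<zero> = \<zero>\<^bsub>M\<^esub>"
proof -
  have "x \<cdot>\<^bsub>M\<^esub> \<zero> \<oplus>\<^bsub>M\<^esub> x \<cdot>\<^bsub>M\<^esub> \<zero> = x \<cdot>\<^bsub>M\<^esub> \<zero>"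
    using assms M.ract_add_right[of x "\<zero>" "\<zero>"] by simp
  then show ?thesis
    using assms by simp
qed

lemma ract_zero_left [simp]:
  assumes "a \<in> carrier R" shows "\<zero>\<^bsub>M\<^esub> \<cdot>\<^bsub>M\<^esub> a = \<zero>\<^bsub>M\<^esub>"
  by (metis M.ract_mult M.zero_closed R.l_null R.zero_closed assms ract_zero_right)

lemma add_ract_uminus:
  assumes "x \<in> carrier M" "a \<in> carrier R"
  shows "x \<cdot>\<^bsub>M\<^esub> a \<oplus>\<^bsub>M\<^esub> x \<cdot>\<^bsub>M\<^esub> (\<ominus> a) = \<zero>\<^bsub>M\<^esub>"
  using assms M.ract_add_right[of x a "\<ominus> a"] by (simp add: R.r_neg)

lemma add_ract_uminus_one:
  assumes "x \<in> carrier M"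
  shows "x \<oplus>\<^bsub>M\<^esub> x \<cdot>\<^bsub>M\<^esub> (\<ominus> \<one>) = \<zero>\<^bsub>M\<^esub>"
  using assms add_ract_uminus[of x "\<one>"] by (simp add: M.ract_one)

lemma ract_uminus_one:
  assumes "x \<in> carrier M"
  shows "x \<cdot>\<^bsub>M\<^esub> (\<ominus> \<one>) = \<ominus>\<^bsub>M\<^esub> x"
  by (metis M.minus_equality M.a_comm R.a_inv_closed R.one_closed add_ract_uminus_one assms ract_closed)

text \<open>The inverse of \<open>x\<close> is \<open>x\<close> acting by minus one, so closure
  under the action already yields closure under negation. Submodules are recognised below through
  this form.\<close>

lemma rsubmodule_iff:
  "rsubmodule R M N \<longleftrightarrow>
     N \<subseteq> carrier M \<and> \<zero>\<^bsub>M\<^esub> \<in> N \<and> (\<forall>x\<in>N. \<forall>y\<in>N. x \<oplus>\<^bsub>M\<^esub> y \<in> N) \<and>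
     (\<forall>x\<in>N. \<forall>a\<in>carrier R. x \<cdot>\<^bsub>M\<^esub> a \<in> N)" (is "?L \<longleftrightarrow> ?R")
proof
  assume ?L
  then show ?R
    unfolding rsubmodule_def
    using additive_subgroup.a_subset additive_subgroup.zero_closed additive_subgroup.a_closed
    by metis
next
  assume r: ?R
  have "additive_subgroup N M"
  proof (rule additive_subgroup.intro, rule M.add.subgroupI)
    fix x assume x: "x \<in> N"
    then have "x \<cdot>\<^bsub>M\<^esub> (\<ominus> \<one>) \<in> N"
      using r by simp
    then show "\<ominus>\<^bsub>M\<^esub> x \<in> N"
      using r x by (metis ract_uminus_one subsetD)
  qed (use r in auto)
  then show ?L
    using r by (simp add: rsubmodule_def)
qed

lemma rsubmoduleI:
  assumes "N \<subseteq> carrier M" "\<zero>\<^bsub>M\<^esub> \<in> N" "\<And>x y. x \<in> N \<Longrightarrow> y \<in> N \<Longrightarrow> x \<oplus>\<^bsub>M\<^esub> y \<in> N"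
    "\<And>x a. x \<in> N \<Longrightarrow> a \<in> carrier R \<Longrightarrow> x \<cdot>\<^bsub>M\<^esub> a \<in> N"
  shows "rsubmodule R M N"
  using assms by (auto simp: rsubmodule_iff)

lemma rsubmodule_carrier: "rsubmodule R M (carrier M)"
  by (auto simp: rsubmodule_iff)

lemma rspan_subset: "rsubmodule R M N \<Longrightarrow> S \<subseteq> N \<Longrightarrow> rspan R M S \<subseteq> N"
  by (auto simp: rspan_def)

lemma subset_rspan: "S \<subseteq> rspan R M S"
  by (auto simp: rspan_def)

lemma rsubmodule_rspan:
  assumes "S \<subseteq> carrier M" shows "rsubmodule R M (rspan R M S)"
proof (rule rsubmoduleI)
  show "rspan R M S \<subseteq> carrier M"
    by (rule rspan_subset[OF rsubmodule_carrier assms])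
qed (auto simp: rspan_def rsubmodule_iff)

lemma rspan_mono: "S \<subseteq> T \<Longrightarrow> rspan R M S \<subseteq> rspan R M T"
  by (auto simp: rspan_def)

lemma rspan_insert_zero: "rspan R M (insert \<zero>\<^bsub>M\<^esub> S) = rspan R M S"
  by (auto simp: rspan_def rsubmodule_iff)

lemma fin_generated_imp_m_generated:
  assumes "fin_generated R M N"
  shows "\<exists>k\<ge>1. m_generated R M k N"
proof -
  obtain S where S: "finite S" "S \<subseteq> carrier M" "N = rspan R M S"
    using assms by (auto simp: fin_generated_def)
  \<comment> \<open>Adjoining zero keeps the span and makes the generating set nonempty, so that its
    cardinality can serve as a \<open>k\<close> with \<open>k \<ge> 1\<close> even when
    \<open>S\<close> is empty.\<close>
  define T where "T = insert \<zero>\<^bsub>M\<^esub> S"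
  have T: "finite T" "T \<subseteq> carrier M" "T \<noteq> {}" and span: "N = rspan R M T"
    using S by (auto simp: T_def rspan_insert_zero)
  obtain h where "bij_betw h {0..<card T} T"
    using ex_bij_betw_nat_finite[OF T(1)] by blast
  then have h: "h ` {..<card T} = T"
    by (simp add: bij_betw_def atLeast0LessThan)
  have "m_generated R M (card T) N"
    unfolding m_generated_def by (rule exI[of _ h]) (use T h span in simp)
  moreover have "card T \<ge> 1"
    using T by (simp add: Suc_leI card_gt_0_iff)
  ultimately show ?thesis by blast
qed

lemma m_generated_imp_fin_generated: "m_generated R M m N \<Longrightarrow> fin_generated R M N"
  unfolding m_generated_def fin_generated_def by blast

end

lemma rmod_hom_zero:
  assumes "rmodule R M" "rmodule R Q" "f \<in> rmod_hom R M Q"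
  shows "f \<zero>\<^bsub>M\<^esub> = \<zero>\<^bsub>Q\<^esub>"
proof -
  interpret M: rmodule R M by fact
  interpret Q: rmodule R Q by fact
  have "f (\<zero>\<^bsub>M\<^esub> \<cdot>\<^bsub>M\<^esub> \<zero>\<^bsub>R\<^esub>) = f \<zero>\<^bsub>M\<^esub> \<cdot>\<^bsub>Q\<^esub> \<zero>\<^bsub>R\<^esub>"
    by (rule rmod_hom_ract[OF assms(3)]) simp_all
  moreover have "f \<zero>\<^bsub>M\<^esub> \<in> carrier Q"
    by (rule rmod_hom_closed[OF assms(3)]) simp
  ultimately show ?thesis by simp
qed

lemma rsubmodule_imp_rmodule:
  assumes "rmodule R M" "rsubmodule R M N"
  shows "rmodule R (M\<lparr>carrier := N\<rparr>)"
proof -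
  interpret M: rmodule R M by fact
  note N = assms(2)[unfolded M.rsubmodule_iff]
  have "abelian_group (M\<lparr>carrier := N\<rparr>)"
  proof (rule abelian_groupI, simp_all add: N)
    fix x assume x: "x \<in> N"
    show "\<exists>y\<in>N. y \<oplus>\<^bsub>M\<^esub> x = \<zero>\<^bsub>M\<^esub>"
    proof (rule bexI)
      show "x \<cdot>\<^bsub>M\<^esub> (\<ominus>\<^bsub>R\<^esub> \<one>\<^bsub>R\<^esub>) \<in> N" using x N by simp
      show "x \<cdot>\<^bsub>M\<^esub> (\<ominus>\<^bsub>R\<^esub> \<one>\<^bsub>R\<^esub>) \<oplus>\<^bsub>M\<^esub> x = \<zero>\<^bsub>M\<^esub>"
        using x N M.add_ract_uminus_one[of x] by (simp add: subset_iff M.M.a_comm)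
    qed
  qed (use N in \<open>auto simp: subset_iff M.M.a_ac M.M.l_zero\<close>)
  then show ?thesis
    unfolding rmodule_iff right_module_def right_module_axioms_def
    using N M.R.ring_axioms
    by (auto simp: subset_iff M.M.ract_add_left M.M.ract_add_right M.M.ract_mult M.M.ract_one)
qed

lemma rsubmodule_image:
  assumes "rmodule R M" "rmodule R Q" "rsubmodule R M N" "f \<in> rmod_hom R (M\<lparr>carrier := N\<rparr>) Q"
  shows "rsubmodule R Q (f ` N)"
proof -
  interpret M: rmodule R M by fact
  interpret Q: rmodule R Q by fact
  note N = assms(3)[unfolded M.rsubmodule_iff]
  have 0: "f \<zero>\<^bsub>M\<^esub> = \<zero>\<^bsub>Q\<^esub>"
    using rmod_hom_zero[OF rsubmodule_imp_rmodule[OF assms(1,3)] assms(2,4)] by simp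
  show ?thesis
  proof (rule Q.rsubmoduleI)
    show "f ` N \<subseteq> carrier Q"
      using rmod_hom_closed[OF assms(4)] by auto
    show "\<zero>\<^bsub>Q\<^esub> \<in> f ` N"
      using N 0 by (metis imageI)
    show "x \<oplus>\<^bsub>Q\<^esub> y \<in> f ` N" if "x \<in> f ` N" "y \<in> f ` N" for x y
    proof -
      from that obtain u v where "u \<in> N" "v \<in> N" "x = f u" "y = f v" by blast
      then show ?thesis
        using N rmod_hom_add[OF assms(4), of u v] by simp (metis imageI)
    qed
    show "x \<cdot>\<^bsub>Q\<^esub> a \<in> f ` N" if "x \<in> f ` N" "a \<in> carrier R" for x a
    proof -
      from that(1) obtain u where "u \<in> N" "x = f u" by blast
      then show ?thesis
        using N that(2) rmod_hom_ract[OF assms(4), of u a] by simp (metis imageI)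
    qed
  qed
qed

text \<open>A homomorphic image needs no more generators than the original; this preserves the
  number \<open>m\<close> when a right ideal is pushed into the radical. One inclusion holds because
  the preimage of the right-hand span is a submodule containing \<open>S\<close>, the other because
  the image of a submodule is a submodule.\<close>

lemma rspan_image:
  assumes "rmodule R M" "rmodule R Q" "p \<in> rmod_hom R M Q" "S \<subseteq> carrier M"
  shows "p ` rspan R M S = rspan R Q (p ` S)"
proof
  interpret M: rmodule R M by fact
  interpret Q: rmodule R Q by fact
  have pS: "p ` S \<subseteq> carrier Q"
    using rmod_hom_closed[OF assms(3)] assms(4) by auto
  note span = M.rsubmodule_rspan[OF assms(4)]
  have sub: "rspan R M S \<subseteq> carrier M"
    using span by (simp add: M.rsubmodule_iff)
  let ?N = "{x \<in> carrier M. p x \<in> rspan R Q (p ` S)}"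
  have "rsubmodule R M ?N"
    using Q.rsubmodule_rspan[OF pS]
    by (auto simp: M.rsubmodule_iff Q.rsubmodule_iff rmod_hom_add[OF assms(3)]
        rmod_hom_ract[OF assms(3)] rmod_hom_zero[OF assms(1-3)])
  moreover have "S \<subseteq> ?N"
    using Q.subset_rspan assms(4) by blast
  ultimately have "rspan R M S \<subseteq> ?N"
    by (rule M.rspan_subset)
  then show "p ` rspan R M S \<subseteq> rspan R Q (p ` S)" by blast
  have "rsubmodule R Q (p ` rspan R M S)"
  proof (rule rsubmodule_image[OF assms(1,2) span])
    show "p \<in> rmod_hom R (M\<lparr>carrier := rspan R M S\<rparr>) Q"
      using assms(3) sub by (simp add: rmod_hom_def Pi_iff subset_iff)
  qed
  then show "rspan R Q (p ` S) \<subseteq> p ` rspan R M S"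
    by (rule Q.rspan_subset) (simp add: M.subset_rspan image_mono)
qed

lemma (in ring) regular_rmodule: "rmodule R (regular_rmod R)"
proof -
  have "abelian_group (regular_rmod R)"
  proof (rule abelian_groupI)
    fix x assume "x \<in> carrier (regular_rmod R)"
    then show "\<exists>y\<in>carrier (regular_rmod R). y \<oplus>\<^bsub>regular_rmod R\<^esub> x = \<zero>\<^bsub>regular_rmod R\<^esub>"
      by (intro bexI[of _ "\<ominus> x"]) (simp_all add: l_neg)
  qed (simp_all add: a_ac)
  then show ?thesis
    unfolding rmodule_iff right_module_def right_module_axioms_def
    using ring_axioms by (auto simp: l_distr r_distr m_assoc)
qed

section \<open>Splitting a submodule along one element and a linear form\<close>

context rmodule
begin

text \<open>This is the map \<open>p\<close> of the overview. The minus sign sits on the scalar, so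
  that linearity follows from the module axioms for the action.\<close>

definition deflate :: "('c \<Rightarrow> 'a) \<Rightarrow> 'c \<Rightarrow> 'c \<Rightarrow> 'c" where
  "deflate \<phi> y x = x \<oplus>\<^bsub>M\<^esub> y \<cdot>\<^bsub>M\<^esub> (\<ominus> \<phi> x)"

lemma deflate_hom:
  assumes "\<phi> \<in> rmod_hom R M R.RR" "y \<in> carrier M"
  shows "deflate \<phi> y \<in> rmod_hom R M M"
proof (rule rmod_homI)
  have \<phi>: "\<phi> x \<in> carrier R" if "x \<in> carrier M" for x
    using rmod_hom_closed[OF assms(1) that] by simp
  fix x assume x: "x \<in> carrier M"
  then show "deflate \<phi> y x \<in> carrier M"
    using assms \<phi> by (simp add: deflate_def)
  { fix z assume z: "z \<in> carrier M"
    show "deflate \<phi> y (x \<oplus>\<^bsub>M\<^esub> z) = deflate \<phi> y x \<oplus>\<^bsub>M\<^esub> deflate \<phi> y z"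
      using assms \<phi> x z rmod_hom_add[OF assms(1) x z]
      by (simp add: deflate_def R.minus_add M.ract_add_right M.a_ac) }
  { fix a assume a: "a \<in> carrier R"
    have "\<ominus> (\<phi> x \<otimes> a) = (\<ominus> \<phi> x) \<otimes> a"
      using \<phi> x a by (simp add: R.l_minus)
    then show "deflate \<phi> y (x \<cdot>\<^bsub>M\<^esub> a) = deflate \<phi> y x \<cdot>\<^bsub>M\<^esub> a"
      using assms \<phi> x a rmod_hom_ract[OF assms(1) x a]
      by (simp add: deflate_def M.ract_mult M.ract_add_left) }
qed

lemma deflate_in:
  assumes "\<phi> \<in> rmod_hom R M R.RR" "rsubmodule R M N" "y \<in> N" "x \<in> N"
  shows "deflate \<phi> y x \<in> N"
  using assms rmod_hom_closed[OF assms(1), of x] by (auto simp: rsubmodule_iff deflate_def)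

text \<open>If \<open>x\<close> and \<open>y\<close> lie in a submodule \<open>N\<close>, then so do
  both summands. A homomorphism defined only on \<open>N\<close> can therefore be evaluated on them
  separately.\<close>

lemma deflate_decomp:
  assumes "\<phi> \<in> rmod_hom R M R.RR" "y \<in> carrier M" "x \<in> carrier M"
  shows "y \<cdot>\<^bsub>M\<^esub> \<phi> x \<oplus>\<^bsub>M\<^esub> deflate \<phi> y x = x"
proof -
  have \<phi>: "\<phi> x \<in> carrier R"
    using rmod_hom_closed[OF assms(1,3)] by simp
  have "y \<cdot>\<^bsub>M\<^esub> \<phi> x \<oplus>\<^bsub>M\<^esub> deflate \<phi> y x = x \<oplus>\<^bsub>M\<^esub> (y \<cdot>\<^bsub>M\<^esub> \<phi> x \<oplus>\<^bsub>M\<^esub> y \<cdot>\<^bsub>M\<^esub> (\<ominus> \<phi> x))"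
    using assms \<phi> by (simp add: deflate_def M.a_ac)
  also have "\<dots> = x"
    using assms \<phi> by (simp add: add_ract_uminus)
  finally show ?thesis .
qed

text \<open>If \<open>\<phi> y\<close> is a left unit modulo \<open>J\<close> for the values of
  \<open>\<phi>\<close> on \<open>N\<close>, this formula shows that \<open>\<phi>\<close> sends the
  deflated elements of \<open>N\<close> into \<open>J\<close>.\<close>

lemma hom_deflate:
  assumes "\<phi> \<in> rmod_hom R M R.RR" "y \<in> carrier M" "x \<in> carrier M"
  shows "\<phi> (deflate \<phi> y x) = \<phi> x \<ominus> \<phi> y \<otimes> \<phi> x"
proof -
  have "\<phi> x \<in> carrier R" "\<phi> y \<in> carrier R"
    using rmod_hom_closed[OF assms(1)] assms by auto
  then show ?thesis
    using assms by (simp add: deflate_def rmod_hom_add[OF assms(1)] rmod_hom_ract[OF assms(1)]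
        R.r_minus R.minus_eq)
qed

lemma extends_to_deflate:
  assumes \<phi>: "\<phi> \<in> rmod_hom R M R.RR" and N: "rsubmodule R M N" and y: "y \<in> N"
    and f: "f \<in> rmod_hom R (M\<lparr>carrier := N\<rparr>) R.RR"
    and ext: "extends_to R M R.RR (deflate \<phi> y ` N) f"
  shows "extends_to R M R.RR N f"
proof -
  obtain g where g: "g \<in> rmod_hom R M R.RR" and gf: "\<And>x. x \<in> N \<Longrightarrow> g (deflate \<phi> y x) = f (deflate \<phi> y x)"
    using ext by (auto simp: extends_to_def)
  have NM: "x \<in> carrier M" if "x \<in> N" for x
    using that N by (auto simp: rsubmodule_iff)
  note p = deflate_hom[OF \<phi> NM[OF y]]
  have fy: "f y \<in> carrier R"
    using rmod_hom_closed[OF f] y by simp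
  have \<phi>c: "\<phi> x \<in> carrier R" if "x \<in> carrier M" for x
    using rmod_hom_closed[OF \<phi> that] by simp
  have gp: "g (deflate \<phi> y x) \<in> carrier R" if "x \<in> carrier M" for x
    using rmod_hom_closed[OF g rmod_hom_closed[OF p that]] by simp
  \<comment> \<open>On \<open>N\<close> the decomposition gives
    \<open>f x = f y \<otimes> \<phi> x \<oplus> f (deflate \<phi> y x)\<close>. Replacing the last
    \<open>f\<close> by \<open>g\<close> gives an expression that is defined and linear on all of
    \<open>M\<close>.\<close>
  define h where "h x = f y \<otimes> \<phi> x \<oplus> g (deflate \<phi> y x)" for x
  have "h \<in> rmod_hom R M R.RR"
  proof (rule rmod_homI)
    fix x assume x: "x \<in> carrier M"
    show "h x \<in> carrier R.RR"
      using x fy \<phi>c gp by (simp add: h_def)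
    { fix z assume z: "z \<in> carrier M"
      show "h (x \<oplus>\<^bsub>M\<^esub> z) = h x \<oplus>\<^bsub>R.RR\<^esub> h z"
        using x z fy \<phi>c gp rmod_hom_closed[OF p]
        by (simp add: h_def rmod_hom_add[OF p] rmod_hom_add[OF \<phi>] rmod_hom_add[OF g] R.r_distr R.a_ac) }
    { fix a assume a: "a \<in> carrier R"
      show "h (x \<cdot>\<^bsub>M\<^esub> a) = h x \<cdot>\<^bsub>R.RR\<^esub> a"
        using x a fy \<phi>c gp rmod_hom_closed[OF p]
        by (simp add: h_def rmod_hom_ract[OF p] rmod_hom_ract[OF \<phi>] rmod_hom_ract[OF g] R.l_distr R.m_assoc) }
  qed
  moreover have "h x = f x" if x: "x \<in> N" for x
  proof -
    have "f (y \<cdot>\<^bsub>M\<^esub> \<phi> x \<oplus>\<^bsub>M\<^esub> deflate \<phi> y x) = f (y \<cdot>\<^bsub>M\<^esub> \<phi> x) \<oplus> f (deflate \<phi> y x)"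
      using rmod_hom_add[OF f, of "y \<cdot>\<^bsub>M\<^esub> \<phi> x" "deflate \<phi> y x"] N x y \<phi>c[OF NM[OF x]]
      by (simp add: deflate_in[OF \<phi> N y x] rsubmodule_iff)
    also have "f (y \<cdot>\<^bsub>M\<^esub> \<phi> x) = f y \<otimes> \<phi> x"
      using rmod_hom_ract[OF f, of y "\<phi> x"] y \<phi>c[OF NM[OF x]] by simp
    finally show ?thesis
      using deflate_decomp[OF \<phi> NM[OF y] NM[OF x]] gf[OF x] by (simp add: h_def)
  qed
  ultimately show ?thesis
    by (auto simp: extends_to_def)
qed

end

section \<open>Right ideals and the Jacobson radical\<close>

context ring
begin

abbreviation "J \<equiv> jacobson_radical R"

interpretation reg: rmodule R "regular_rmod R"
  by (rule regular_rmodule)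

lemma right_ideal_iff:
  "right_ideal R I \<longleftrightarrow>
     I \<subseteq> carrier R \<and> \<zero> \<in> I \<and> (\<forall>x\<in>I. \<forall>y\<in>I. x \<oplus> y \<in> I) \<and> (\<forall>x\<in>I. \<forall>a\<in>carrier R. x \<otimes> a \<in> I)"
  by (simp add: right_ideal_def reg.rsubmodule_iff)

lemma right_ideal_carrier: "right_ideal R (carrier R)"
  by (simp add: right_ideal_iff)

lemma right_ideal_inter: "right_ideal R I \<Longrightarrow> right_ideal R K \<Longrightarrow> right_ideal R (I \<inter> K)"
  by (auto simp: right_ideal_iff)

lemma right_ideal_minus:
  assumes "right_ideal R I" "x \<in> I" "y \<in> I"
  shows "x \<ominus> y \<in> I"
proof -
  have c: "x \<in> carrier R" "y \<in> carrier R"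
    using assms by (auto simp: right_ideal_iff)
  have "x \<oplus> y \<otimes> (\<ominus> \<one>) \<in> I"
    using assms by (simp add: right_ideal_iff)
  then show ?thesis
    using c by (simp add: r_minus minus_eq)
qed

lemma right_ideal_one:
  assumes "right_ideal R I" "\<one> \<in> I"
  shows "I = carrier R"
proof
  show "I \<subseteq> carrier R"
    using assms by (simp add: right_ideal_iff)
  show "carrier R \<subseteq> I"
  proof
    fix a assume a: "a \<in> carrier R"
    then have "\<one> \<otimes> a \<in> I"
      using assms by (simp add: right_ideal_iff del: l_one)
    then show "a \<in> I"
      using a by simp
  qed
qed

section \<open>Sums of right ideals and maximal right ideals\<close>

lemma mem_set_add: "(x :: 'a) \<in> A <+> B \<longleftrightarrow> (\<exists>a\<in>A. \<exists>b\<in>B. x = a \<oplus> b)"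
  by (auto simp: set_add_def set_mult_def)

lemma right_ideal_set_add:
  assumes I: "right_ideal R I" and K: "right_ideal R K"
  shows "right_ideal R (I <+> K)"
  unfolding right_ideal_iff
proof (intro conjI ballI)
  have c: "x \<in> carrier R" if "x \<in> I \<or> x \<in> K" for x
    using that I K by (auto simp: right_ideal_iff)
  show "I <+> K \<subseteq> carrier R"
    using c by (auto simp: mem_set_add)
  show "\<zero> \<in> I <+> K"
    using I K by (auto simp: mem_set_add right_ideal_iff intro!: bexI[of _ "\<zero>"])
  fix x :: 'a assume "x \<in> I <+> K"
  then obtain a b where ab: "a \<in> I" "b \<in> K" "x = a \<oplus> b" by (auto simp: mem_set_add)
  { fix y :: 'a assume "y \<in> I <+> K"
    then obtain c d where cd: "c \<in> I" "d \<in> K" "y = c \<oplus> d" by (auto simp: mem_set_add)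
    have "x \<oplus> y = (a \<oplus> c) \<oplus> (b \<oplus> d)"
      using ab cd c by (simp add: a_ac)
    moreover have "a \<oplus> c \<in> I" "b \<oplus> d \<in> K"
      using ab cd I K by (auto simp: right_ideal_iff)
    ultimately show "x \<oplus> y \<in> I <+> K"
      unfolding mem_set_add by blast }
  { fix r assume r: "r \<in> carrier R"
    have "x \<otimes> r = a \<otimes> r \<oplus> b \<otimes> r"
      using ab c r by (simp add: l_distr)
    moreover have "a \<otimes> r \<in> I" "b \<otimes> r \<in> K"
      using ab r I K by (auto simp: right_ideal_iff)
    ultimately show "x \<otimes> r \<in> I <+> K"
      unfolding mem_set_add by blast }
qed

lemma set_add_supset:
  assumes "right_ideal R I" "right_ideal R K"
  shows "I \<subseteq> I <+> K" "K \<subseteq> I <+> K"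
proof -
  have "x = x \<oplus> \<zero>" "x = \<zero> \<oplus> x" if "x \<in> carrier R" for x
    using that by simp_all
  then show "I \<subseteq> I <+> K" "K \<subseteq> I <+> K"
    using assms unfolding right_ideal_iff subset_iff mem_set_add by blast+
qed

lemma maximal_right_ideal_set_add:
  assumes "maximal_right_ideal R M" "right_ideal R K" "\<not> K \<subseteq> M"
  shows "K <+> M = carrier R"
  using assms set_add_supset[of K M] right_ideal_set_add[of K M]
  unfolding maximal_right_ideal_def by blast

text \<open>Zorn's lemma is applied to the right ideals above \<open>K\<close> that avoid
  \<open>\<one>\<close>. For right ideals this is the same as being proper, and it visibly passes to
  unions of chains.\<close>

lemma exists_maximal_right_ideal:
  assumes "right_ideal R K" "K \<noteq> carrier R"
  shows "\<exists>M. maximal_right_ideal R M \<and> K \<subseteq> M"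
proof -
  let ?A = "{I. right_ideal R I \<and> K \<subseteq> I \<and> \<one> \<notin> I}"
  have "\<exists>M\<in>?A. \<forall>X\<in>?A. M \<subseteq> X \<longrightarrow> X = M"
  proof (rule subset_Zorn_nonempty)
    show "?A \<noteq> {}"
      using assms right_ideal_one by auto
    fix C assume C: "C \<noteq> {}" "subset.chain ?A C"
    have el: "right_ideal R I" "K \<subseteq> I" "\<one> \<notin> I" if "I \<in> C" for I
      using that C(2) unfolding subset_chain_def by blast+
    have "right_ideal R (\<Union>C)"
      unfolding right_ideal_iff
    proof (intro conjI ballI)
      show "\<Union>C \<subseteq> carrier R" "\<zero> \<in> \<Union>C"
        using C(1) el(1) unfolding right_ideal_iff by blast+
      fix x assume "x \<in> \<Union>C"
      then obtain X where X: "X \<in> C" "x \<in> X" by blast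
      then show "x \<otimes> a \<in> \<Union>C" if "a \<in> carrier R" for a
        using X el(1)[OF X(1)] that unfolding right_ideal_iff by blast
      fix y assume "y \<in> \<Union>C"
      then obtain Y where Y: "Y \<in> C" "y \<in> Y" by blast
      have "X \<subseteq> Y \<or> Y \<subseteq> X"
        using C(2) X Y unfolding subset_chain_def by blast
      then have "x \<oplus> y \<in> X \<or> x \<oplus> y \<in> Y"
        using X Y el(1)[OF X(1)] el(1)[OF Y(1)] unfolding right_ideal_iff by blast
      then show "x \<oplus> y \<in> \<Union>C"
        using X Y by blast
    qed
    then show "\<Union>C \<in> ?A"
      using C(1) el by blast
  qed
  then obtain M where "M \<in> ?A" and max: "\<forall>X\<in>?A. M \<subseteq> X \<longrightarrow> X = M"
    by (elim bexE)
  then have M: "right_ideal R M" "K \<subseteq> M" "\<one> \<notin> M"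
    by simp_all
  have "L = M \<or> L = carrier R" if L: "right_ideal R L" "M \<subseteq> L" for L
  proof (cases "\<one> \<in> L")
    case True
    then show ?thesis
      using right_ideal_one[OF L(1)] by simp
  next
    case False
    then have "L \<in> ?A"
      using L M(2) by simp
    then show ?thesis
      using max L(2) by simp
  qed
  moreover have "M \<noteq> carrier R"
    using M(3) by auto
  ultimately have "maximal_right_ideal R M"
    using M(1) by (simp add: maximal_right_ideal_def)
  with M show ?thesis by blast
qed

lemma right_ideal_radical: "right_ideal R J"
  by (auto simp: right_ideal_iff jacobson_radical_def maximal_right_ideal_def)

lemma radical_subset_maximal: "maximal_right_ideal R M \<Longrightarrow> J \<subseteq> M"
  by (auto simp: jacobson_radical_def)

lemma radical_subset_carrier: "J \<subseteq> carrier R"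
  by (auto simp: jacobson_radical_def)

text \<open>A proper right ideal \<open>K\<close> lies in a maximal one, which contains
  \<open>J\<close> and hence \<open>I\<close> as well. The sum of \<open>I\<close> and
  \<open>K\<close> stays inside it.\<close>

lemma small_right_idealI:
  assumes "right_ideal R I" "I \<subseteq> J"
  shows "small_right_ideal R I"
  unfolding small_right_ideal_def
proof (intro conjI allI impI)
  fix K assume "right_ideal R K \<and> K \<noteq> carrier R"
  then obtain M where M: "maximal_right_ideal R M" "K \<subseteq> M"
    using exists_maximal_right_ideal by blast
  have Mr: "right_ideal R M" "M \<noteq> carrier R"
    using M(1) by (simp_all add: maximal_right_ideal_def)
  have "I \<subseteq> M"
    using assms(2) radical_subset_maximal[OF M(1)] by blast
  then have "I <+> K \<subseteq> M"
    using M(2) Mr(1) by (auto simp: mem_set_add right_ideal_iff subset_iff)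
  then show "I <+> K \<noteq> carrier R"
    using Mr by (auto simp: right_ideal_iff)
qed fact

text \<open>The set \<open>?L\<close> is the kernel of the map from \<open>R\<close> to the simple
  module \<open>R/M\<close> that sends \<open>y\<close> to the class of
  \<open>r \<otimes> y\<close>. A nonzero map onto a simple module has a maximal kernel; the proof
  carries this out with elements.\<close>

lemma maximal_right_ideal_colon:
  assumes M: "maximal_right_ideal R M" and r: "r \<in> carrier R"
    and neq: "{y \<in> carrier R. r \<otimes> y \<in> M} \<noteq> carrier R" (is "?L \<noteq> _")
  shows "maximal_right_ideal R ?L"
  unfolding maximal_right_ideal_def
proof (intro conjI allI impI)
  have Mr: "right_ideal R M"
    using M by (simp add: maximal_right_ideal_def)
  have Mc: "m \<in> carrier R" if "m \<in> M" for m
    using that Mr by (auto simp: right_ideal_iff)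
  show "right_ideal R ?L"
    using Mr r by (auto simp: right_ideal_iff r_distr simp flip: m_assoc)
  fix K assume K: "right_ideal R K \<and> ?L \<subseteq> K"
  then have Kc: "k \<in> carrier R" if "k \<in> K" for k
    using that by (auto simp: right_ideal_iff)
  show "K = ?L \<or> K = carrier R"
  proof (rule disjCI)
    assume "K \<noteq> carrier R"
    show "K = ?L"
    proof (rule ccontr)
      assume "K \<noteq> ?L"
      then obtain k where k: "k \<in> K" "r \<otimes> k \<notin> M"
        using K Kc by blast
      \<comment> \<open>Since \<open>r \<otimes> k\<close> is outside \<open>M\<close>, the right
        ideal it generates and \<open>M\<close> add up to \<open>R\<close>. Writing
        \<open>r \<otimes> z = r \<otimes> k \<otimes> s \<oplus> m\<close> puts
        \<open>z \<ominus> k \<otimes> s\<close> into \<open>?L\<close>, hence into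
        \<open>K\<close>, and then \<open>z\<close> lies in \<open>K\<close> too.\<close>
      let ?rk = "(\<lambda>s. r \<otimes> k \<otimes> s) ` carrier R"
      have "right_ideal R ?rk"
        using r Kc[OF k(1)]
        by (auto simp: right_ideal_iff m_assoc image_iff simp flip: r_distr intro: bexI[of _ "\<zero>"])
      moreover have "r \<otimes> k \<in> ?rk"
        using r Kc[OF k(1)] by (auto intro!: image_eqI[of _ _ "\<one>"])
      ultimately have sum: "?rk <+> M = carrier R"
        using maximal_right_ideal_set_add[OF M] k by blast
      have "z \<in> K" if z: "z \<in> carrier R" for z
      proof -
        have "r \<otimes> z \<in> ?rk <+> M"
          using sum z r by simp
        then obtain s m where s: "s \<in> carrier R" "m \<in> M" "r \<otimes> z = r \<otimes> k \<otimes> s \<oplus> m"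
          by (auto simp: mem_set_add)
        note c = r z s(1) Kc[OF k(1)] Mc[OF s(2)]
        have "r \<otimes> (z \<ominus> k \<otimes> s) = r \<otimes> z \<ominus> r \<otimes> k \<otimes> s"
          using c by (simp add: minus_eq r_distr r_minus m_assoc)
        also have "\<dots> = m"
          using c by (simp add: s(3) minus_eq a_assoc a_comm[of m] r_neg2)
        finally have "z \<ominus> k \<otimes> s \<in> K"
          using K c s by auto
        moreover have "k \<otimes> s \<in> K"
          using K k s by (auto simp: right_ideal_iff)
        ultimately have "(z \<ominus> k \<otimes> s) \<oplus> k \<otimes> s \<in> K"
          using K by (auto simp: right_ideal_iff)
        then show "z \<in> K"
          using c by (simp add: minus_eq a_assoc l_neg)
      qed
      then show False
        using \<open>K \<noteq> carrier R\<close> Kc by blast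
    qed
  qed
qed fact

text \<open>For each maximal \<open>M\<close> the right ideal of all \<open>y\<close> with
  \<open>r \<otimes> y \<in> M\<close> is either maximal or the whole ring, and in both cases it
  contains \<open>x\<close>. With this \<open>J\<close> is two-sided and the quotient ring makes
  sense.\<close>

lemma radical_left_closed:
  assumes "x \<in> J" "r \<in> carrier R"
  shows "r \<otimes> x \<in> J"
proof -
  have x: "x \<in> carrier R"
    using assms(1) radical_subset_carrier by blast
  have "r \<otimes> x \<in> M" if M: "maximal_right_ideal R M" for M
    using maximal_right_ideal_colon[OF M assms(2)] radical_subset_maximal assms(1) x by blast
  then show ?thesis
    using x assms by (simp add: jacobson_radical_def)
qed

lemma ideal_radical: "ideal J R"
proof (rule idealI[OF ring_axioms])
  show "subgroup J (add_monoid R)"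
  proof (rule add.subgroupI)
    fix x assume "x \<in> J"
    moreover have "\<zero> \<in> J"
      using right_ideal_radical by (simp add: right_ideal_iff)
    ultimately have "\<zero> \<ominus> x \<in> J"
      by (rule right_ideal_minus[OF right_ideal_radical, rotated])
    then show "\<ominus> x \<in> J"
      using \<open>x \<in> J\<close> radical_subset_carrier by (auto simp: minus_eq)
  qed (use right_ideal_radical in \<open>auto simp: right_ideal_iff\<close>)
qed (use right_ideal_radical radical_left_closed in \<open>auto simp: right_ideal_iff\<close>)

end

section \<open>Left units modulo the radical\<close>

context ring
begin

interpretation reg: rmodule R "regular_rmod R"
  by (rule regular_rmodule)

interpretation JI: ideal J R
  by (rule ideal_radical)

interpretation Q: ring "R Quot J"
  by (rule JI.quotient_is_ring)

interpretation \<pi>: ring_hom_ring R "R Quot J" "(+>) J"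
  by (rule JI.rcos_ring_hom_ring)

lemma radical_coset_eq_iff:
  assumes "a \<in> carrier R" "b \<in> carrier R"
  shows "J +> a = J +> b \<longleftrightarrow> a \<ominus> b \<in> J"
  by (metis JI.a_rcos_module_minus JI.a_repr_independence' JI.a_rcos_self assms ring_axioms)

lemma carrier_Quot: "carrier (R Quot J) = (+>) J ` carrier R"
  by (auto simp: FactRing_def A_RCOSETS_defs a_r_coset_def)

lemma right_ideal_quot_image:
  assumes "right_ideal R K"
  shows "right_ideal (R Quot J) ((+>) J ` K)"
  unfolding Q.right_ideal_iff
proof (intro conjI ballI)
  have Kc: "k \<in> carrier R" if "k \<in> K" for k
    using that assms by (auto simp: right_ideal_iff)
  show "(+>) J ` K \<subseteq> carrier (R Quot J)"
    using Kc by auto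
  show "\<zero>\<^bsub>R Quot J\<^esub> \<in> (+>) J ` K"
    using assms by (auto simp: right_ideal_iff intro!: image_eqI[of _ _ "\<zero>"])
  fix x assume "x \<in> (+>) J ` K"
  then obtain k where k: "k \<in> K" "x = J +> k" by blast
  { fix y assume "y \<in> (+>) J ` K"
    then obtain l where l: "l \<in> K" "y = J +> l" by blast
    have "x \<oplus>\<^bsub>R Quot J\<^esub> y = J +> (k \<oplus> l)"
      using k l Kc by simp
    then show "x \<oplus>\<^bsub>R Quot J\<^esub> y \<in> (+>) J ` K"
      using k l assms by (auto simp: right_ideal_iff) }
  { fix y assume "y \<in> carrier (R Quot J)"
    then obtain r where r: "r \<in> carrier R" "y = J +> r" by (auto simp: carrier_Quot)
    have "x \<otimes>\<^bsub>R Quot J\<^esub> y = J +> (k \<otimes> r)"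
      using k r Kc by simp
    then show "x \<otimes>\<^bsub>R Quot J\<^esub> y \<in> (+>) J ` K"
      using k r assms by (auto simp: right_ideal_iff) }
qed

text \<open>Such a \<open>K\<close> is found as a minimal right ideal above \<open>J\<close> with \<open>U + K = R\<close>: a maximal right
  ideal \<open>M\<close> not containing \<open>U \<inter> K\<close> would allow to replace \<open>K\<close> by \<open>K \<inter> M\<close>.\<close>

lemma weak_supplement:
  assumes "right_artinian (R Quot J)" and U: "right_ideal R U"
  shows "\<exists>K. right_ideal R K \<and> U <+> K = carrier R \<and> U \<inter> K \<subseteq> J"
proof (rule ccontr)
  \<comment> \<open>The condition \<open>J \<subseteq> K\<close> ensures that a strict inclusion
    between such right ideals remains strict in the quotient by \<open>J\<close>.\<close>
  define P where "P K \<longleftrightarrow> right_ideal R K \<and> J \<subseteq> K \<and> U <+> K = carrier R" for K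
  assume "\<not> ?thesis"
  then have no: "\<not> U \<inter> K \<subseteq> J" if "P K" for K
    using that by (auto simp: P_def)
  have "\<exists>K'. P K' \<and> K' \<subset> K" if PK: "P K" for K
  proof -
    have K: "right_ideal R K" "J \<subseteq> K" "U <+> K = carrier R"
      using PK by (auto simp: P_def)
    have Kc: "k \<in> carrier R" if "k \<in> K" for k
      using that K by (auto simp: right_ideal_iff)
    have Uc: "u \<in> carrier R" if "u \<in> U" for u
      using that U by (auto simp: right_ideal_iff)
    obtain x where x: "x \<in> U \<inter> K" "x \<notin> J"
      using no[OF PK] by blast
    then obtain M where xM: "x \<notin> M" and M: "maximal_right_ideal R M"
      using Kc[of x] unfolding jacobson_radical_def by blast
    have Mr: "right_ideal R M"
      using M by (simp add: maximal_right_ideal_def)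
    have sum: "(U \<inter> K) <+> M = carrier R"
      using maximal_right_ideal_set_add[OF M right_ideal_inter[OF U K(1)]] x(1) xM by blast
    \<comment> \<open>Write \<open>r = u \<oplus> k\<close> and then \<open>k = v \<oplus> m\<close>
      with \<open>v\<close> in both \<open>U\<close> and \<open>K\<close>. Regrouping as
      \<open>(u \<oplus> v) \<oplus> m\<close> works because \<open>m = k \<ominus> v\<close> lies
      in \<open>K\<close> as well as in \<open>M\<close>.\<close>
    have "r \<in> U <+> (K \<inter> M)" if r: "r \<in> carrier R" for r :: 'a
    proof -
      have "r \<in> U <+> K"
        using r K(3) by simp
      then obtain u k where uk: "u \<in> U" "k \<in> K" "r = u \<oplus> k"
        unfolding mem_set_add by blast
      have "k \<in> (U \<inter> K) <+> M"
        using sum Kc[OF uk(2)] by simp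
      then obtain v m where vm: "v \<in> U \<inter> K" "m \<in> M" "k = v \<oplus> m"
        unfolding mem_set_add by blast
      have mc: "m \<in> carrier R"
        using vm(2) Mr by (auto simp: right_ideal_iff)
      have c: "u \<in> carrier R" "k \<in> carrier R" "v \<in> carrier R"
        using uk vm Uc Kc by auto
      have "m = k \<ominus> v"
        using c mc by (simp add: vm(3) minus_eq a_assoc a_comm[of m] r_neg2)
      then have "m \<in> K"
        using right_ideal_minus[OF K(1)] uk vm by blast
      moreover have "u \<oplus> v \<in> U"
        using uk vm U by (auto simp: right_ideal_iff)
      moreover have "r = (u \<oplus> v) \<oplus> m"
        using uk vm c mc by (simp add: a_assoc)
      ultimately show ?thesis
        unfolding mem_set_add using vm(2) by blast
    qed
    then have "U <+> (K \<inter> M) = carrier R"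
      using right_ideal_set_add[OF U right_ideal_inter[OF K(1) Mr]]
      by (auto simp: right_ideal_iff)
    then have "P (K \<inter> M)"
      using K Mr radical_subset_maximal[OF M] by (simp add: P_def right_ideal_inter)
    then show ?thesis
      using x(1) xM by blast
  qed
  moreover have "P (carrier R)"
    using right_ideal_carrier radical_subset_carrier right_ideal_set_add[OF U right_ideal_carrier]
      set_add_supset(2)[OF U right_ideal_carrier]
    by (auto simp: P_def right_ideal_iff)
  \<comment> \<open>Dependent choice turns the descent into an infinite strictly decreasing chain,
    whose image in the quotient must become stationary.\<close>
  ultimately have "\<exists>K. \<forall>n. P (K n) \<and> K (Suc n) \<subset> K n"
    using dependent_nat_choice[of "\<lambda>_. P" "\<lambda>_ K K'. K' \<subset> K"] by blast
  then obtain K where K: "\<And>n. P (K n)" "\<And>n. K (Suc n) \<subset> K n"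
    by blast
  have "\<forall>n. right_ideal (R Quot J) ((+>) J ` K n) \<and> (+>) J ` K (Suc n) \<subseteq> (+>) J ` K n"
    using K(1) psubset_imp_subset[OF K(2)] right_ideal_quot_image image_mono
    unfolding P_def by blast
  then obtain k where "\<forall>n\<ge>k. (+>) J ` K n = (+>) J ` K k"
    using assms(1)[unfolded right_artinian_def] by meson
  then have eq: "(+>) J ` K (Suc k) = (+>) J ` K k"
    by (rule allE[of _ "Suc k"]) (erule mp, simp)
  \<comment> \<open>An \<open>x\<close> lost at stage \<open>Suc k\<close> still has the same coset
    as some \<open>y\<close> in \<open>K (Suc k)\<close>. Their difference lies in \<open>J\<close>,
    hence in \<open>K (Suc k)\<close>, which forces \<open>x\<close> back into it.\<close>
  obtain x where x: "x \<in> K k" "x \<notin> K (Suc k)"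
    using K(2)[of k] by blast
  then obtain y where y: "y \<in> K (Suc k)" "J +> x = J +> y"
    using eq by (metis imageE imageI)
  have ri: "right_ideal R (K n)" "J \<subseteq> K n" for n
    using K(1)[of n] by (auto simp: P_def)
  have c: "x \<in> carrier R" "y \<in> carrier R"
    using x(1) y(1) ri(1) unfolding right_ideal_iff by blast+
  then have "x \<ominus> y \<in> K (Suc k)"
    using y ri(2) by (auto simp: radical_coset_eq_iff)
  then have "(x \<ominus> y) \<oplus> y \<in> K (Suc k)"
    using y ri(1)[of "Suc k"] by (auto simp: right_ideal_iff)
  then show False
    using x c by (simp add: minus_eq a_assoc l_neg)
qed

lemma left_unit_modulo_radical_artinian:
  assumes "right_artinian (R Quot J)" and U: "right_ideal R U"
  shows "\<exists>e\<in>U. \<forall>u\<in>U. u \<ominus> e \<otimes> u \<in> J"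
proof -
  obtain K where K: "right_ideal R K" "U <+> K = carrier R" "U \<inter> K \<subseteq> J"
    using weak_supplement[OF assms] by blast
  have "\<one> \<in> U <+> K"
    using K by simp
  then obtain e k where ek: "e \<in> U" "k \<in> K" "\<one> = e \<oplus> k"
    by (auto simp: mem_set_add)
  have c: "e \<in> carrier R" "k \<in> carrier R"
    using ek U K by (auto simp: right_ideal_iff)
  have "u \<ominus> e \<otimes> u \<in> J" if u: "u \<in> U" for u
  proof -
    have uc: "u \<in> carrier R"
      using u U by (auto simp: right_ideal_iff)
    have "u = e \<otimes> u \<oplus> k \<otimes> u"
      using ek(3) c uc by (metis l_distr l_one)
    then have "u \<ominus> e \<otimes> u = (e \<otimes> u \<oplus> k \<otimes> u) \<ominus> e \<otimes> u"
      by simp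
    also have "\<dots> = k \<otimes> u"
      using c uc by (simp add: minus_eq a_assoc a_comm[of "k \<otimes> u"] r_neg2)
    finally have "u \<ominus> e \<otimes> u \<in> K"
      using K ek uc by (auto simp: right_ideal_iff)
    moreover have "e \<otimes> u \<in> U"
      using U ek uc by (auto simp: right_ideal_iff)
    then have "u \<ominus> e \<otimes> u \<in> U"
      by (rule right_ideal_minus[OF U u])
    ultimately show ?thesis
      using K(3) by blast
  qed
  with ek show ?thesis by blast
qed

text \<open>The left unit is built by adding one generator at a time. It suffices to treat
  generators, since the elements fixed modulo \<open>J\<close> by left multiplication with
  \<open>e\<close> form a right ideal.\<close>

lemma left_unit_modulo_radical_regular:
  assumes vnr: "von_neumann_regular (R Quot J)" and S: "finite S" "S \<subseteq> carrier R"
  shows "\<exists>e\<in>rspan R RR S. \<forall>u\<in>rspan R RR S. u \<ominus> e \<otimes> u \<in> J"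
proof -
  have span_c: "x \<in> carrier R" if "x \<in> rspan R RR T" "T \<subseteq> carrier R" for x T
    using reg.rsubmodule_rspan[of T] that by (auto simp: reg.rsubmodule_iff)
  have "\<exists>e\<in>rspan R RR S. \<forall>s\<in>S. J +> e \<otimes> s = J +> s"
    using S
  proof (induction S)
    case empty
    then show ?case
      using reg.rsubmodule_rspan[of "{}"] by (auto simp: reg.rsubmodule_iff)
  next
    case (insert b S)
    let ?U = "rspan R RR (insert b S)"
    have U: "right_ideal R ?U"
      using reg.rsubmodule_rspan[of "insert b S"] insert.prems by (simp add: right_ideal_def)
    have b: "b \<in> carrier R" "b \<in> ?U"
      using insert.prems reg.subset_rspan[of "insert b S"] by auto
    from insert obtain e where e: "e \<in> rspan R RR S" "\<And>s. s \<in> S \<Longrightarrow> J +> e \<otimes> s = J +> s"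
      by auto
    have eU: "e \<in> ?U"
      using e(1) reg.rspan_mono[of S "insert b S"] by blast
    have ec: "e \<in> carrier R"
      using e(1) insert.prems span_c by blast
    define c where "c = b \<ominus> e \<otimes> b"
    have cc: "c \<in> carrier R"
      using b ec by (simp add: c_def)
    have cU: "c \<in> ?U"
      using right_ideal_minus[OF U] U eU b by (auto simp: c_def right_ideal_iff)
    obtain d where d: "d \<in> carrier R" "J +> c \<otimes> d \<otimes> c = J +> c"
    proof -
      have "J +> c \<in> carrier (R Quot J)"
        using cc by simp
      then obtain D where "D \<in> carrier (R Quot J)"
        "J +> c = (J +> c) \<otimes>\<^bsub>R Quot J\<^esub> D \<otimes>\<^bsub>R Quot J\<^esub> (J +> c)"
        using vnr unfolding von_neumann_regular_def by blast
      then show thesis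
        using that cc by (auto simp: carrier_Quot)
    qed
    \<comment> \<open>Here \<open>c\<close> is the part of \<open>b\<close> that \<open>e\<close>
      misses and \<open>d\<close> is a quasi-inverse of \<open>c\<close> modulo \<open>J\<close>.
      Multiplying \<open>x\<close> by \<open>s\<close> adds
      \<open>c \<otimes> d \<otimes> (s \<ominus> e \<otimes> s)\<close> to
      \<open>e \<otimes> s\<close>. Modulo \<open>J\<close> this correction vanishes for the old
      generators, while for \<open>b\<close> it equals \<open>c \<otimes> d \<otimes> c\<close>,
      that is \<open>c\<close>, as required.\<close>
    define x where "x = e \<oplus> c \<otimes> (d \<otimes> (\<one> \<ominus> e))"
    have "x \<in> ?U"
      using U eU cU d ec by (auto simp: x_def right_ideal_iff)
    moreover have "J +> x \<otimes> s = J +> s" if s: "s \<in> insert b S" for s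
    proof -
      have sc: "s \<in> carrier R"
        using s insert.prems by auto
      have "x \<otimes> s = e \<otimes> s \<oplus> c \<otimes> d \<otimes> (s \<ominus> e \<otimes> s)"
        using sc ec cc d by (simp add: x_def minus_eq l_distr l_minus m_assoc)
      then have *: "J +> x \<otimes> s = (J +> e \<otimes> s) \<oplus>\<^bsub>R Quot J\<^esub> (J +> c \<otimes> d \<otimes> (s \<ominus> e \<otimes> s))"
        using sc ec cc d by simp
      show ?thesis
      proof (cases "s \<in> S")
        case True
        have "J +> (s \<ominus> e \<otimes> s) = \<zero>\<^bsub>R Quot J\<^esub>"
          using e(2)[OF True] sc ec by (simp add: minus_eq Q.r_neg)
        then have "J +> c \<otimes> d \<otimes> (s \<ominus> e \<otimes> s) = \<zero>\<^bsub>R Quot J\<^esub>"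
          using sc ec cc d by simp
        then show ?thesis
          using * e(2)[OF True] sc ec by (metis Q.r_zero \<pi>.hom_closed)
      next
        case False
        then have "s = b" using s by simp
        then have "J +> x \<otimes> s = J +> (e \<otimes> s \<oplus> c)"
          using * d sc ec cc c_def by simp
        also have "e \<otimes> s \<oplus> c = s"
          using \<open>s = b\<close> sc ec by (simp add: c_def minus_eq a_comm[of b "\<ominus> (e \<otimes> b)"] r_neg2)
        finally show ?thesis .
      qed
    qed
    ultimately show ?case by blast
  qed
  then obtain e where e: "e \<in> rspan R RR S" "\<And>s. s \<in> S \<Longrightarrow> J +> e \<otimes> s = J +> s"
    by blast
  have ec: "e \<in> carrier R"
    using e(1) S span_c by blast
  let ?N = "{u \<in> carrier R. J +> e \<otimes> u = J +> u}"
  have "rsubmodule R RR ?N"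
    using ec by (auto simp: reg.rsubmodule_iff r_distr simp flip: m_assoc)
  then have "rspan R RR S \<subseteq> ?N"
    by (rule reg.rspan_subset) (use S e in auto)
  then have "u \<ominus> e \<otimes> u \<in> J" if "u \<in> rspan R RR S" for u
    using that ec radical_coset_eq_iff[of u "e \<otimes> u"] by auto
  with e(1) show ?thesis by blast
qed

end

section \<open>Baer's criterion\<close>

text \<open>Extensions of \<open>f\<close> are handled as graphs; since a graph closed under addition and scalars is
  right unique as soon as \<open>\<zero>\<close> is only related to \<open>\<zero>\<close>, that is all the predicate asks for.\<close>

definition hom_graph ::
  "('a, 'c) ring_scheme \<Rightarrow> ('a, 'm, 'd) rmod_scheme \<Rightarrow> ('a, 'n, 'e) rmod_scheme \<Rightarrow> ('m \<times> 'n) set \<Rightarrow> bool"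
  where
  "hom_graph R M Q G \<longleftrightarrow> G \<subseteq> carrier M \<times> carrier Q \<and>
     (\<forall>x y x' y'. (x, y) \<in> G \<longrightarrow> (x', y') \<in> G \<longrightarrow> (x \<oplus>\<^bsub>M\<^esub> x', y \<oplus>\<^bsub>Q\<^esub> y') \<in> G) \<and>
     (\<forall>x y. \<forall>a\<in>carrier R. (x, y) \<in> G \<longrightarrow> (x \<cdot>\<^bsub>M\<^esub> a, y \<cdot>\<^bsub>Q\<^esub> a) \<in> G) \<and>
     (\<forall>y. (\<zero>\<^bsub>M\<^esub>, y) \<in> G \<longrightarrow> y = \<zero>\<^bsub>Q\<^esub>)"

lemma hom_graph_functional:
  assumes "rmodule R M" "rmodule R Q" and G: "hom_graph R M Q G" and xy: "(x, y) \<in> G" "(x, y') \<in> G"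
  shows "y = y'"
proof -
  interpret M: rmodule R M by fact
  interpret Q: rmodule R Q by fact
  let ?m = "\<ominus>\<^bsub>R\<^esub> \<one>\<^bsub>R\<^esub>"
  have c: "x \<in> carrier M" "y \<in> carrier Q" "y' \<in> carrier Q"
    using G xy unfolding hom_graph_def by blast+
  have "(x \<cdot>\<^bsub>M\<^esub> ?m, y' \<cdot>\<^bsub>Q\<^esub> ?m) \<in> G"
    using G xy M.R.a_inv_closed[OF M.R.one_closed] unfolding hom_graph_def by blast
  then have "(x \<oplus>\<^bsub>M\<^esub> x \<cdot>\<^bsub>M\<^esub> ?m, y \<oplus>\<^bsub>Q\<^esub> y' \<cdot>\<^bsub>Q\<^esub> ?m) \<in> G"
    using G xy unfolding hom_graph_def by blast
  then have "y \<oplus>\<^bsub>Q\<^esub> y' \<cdot>\<^bsub>Q\<^esub> ?m = \<zero>\<^bsub>Q\<^esub>"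
    using G c unfolding hom_graph_def by (simp add: M.add_ract_uminus_one)
  then show ?thesis
    using c Q.M.minus_equality[of "y" "\<ominus>\<^bsub>Q\<^esub> y'"] by (simp add: Q.ract_uminus_one)
qed

lemma hom_graph_Union:
  assumes C: "\<And>G. G \<in> C \<Longrightarrow> hom_graph R M Q G"
    and chain: "\<And>G H. G \<in> C \<Longrightarrow> H \<in> C \<Longrightarrow> G \<subseteq> H \<or> H \<subseteq> G"
  shows "hom_graph R M Q (\<Union>C)"
  unfolding hom_graph_def
proof (intro conjI allI impI ballI)
  show "\<Union>C \<subseteq> carrier M \<times> carrier Q"
    using C unfolding hom_graph_def by (intro Union_least) simp
  show "y = \<zero>\<^bsub>Q\<^esub>" if "(\<zero>\<^bsub>M\<^esub>, y) \<in> \<Union>C" for y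
    using that C unfolding hom_graph_def by (elim UnionE) simp
  fix x y assume "(x, y) \<in> \<Union>C"
  then obtain G where G: "G \<in> C" "(x, y) \<in> G" by (elim UnionE)
  show "(x \<cdot>\<^bsub>M\<^esub> a, y \<cdot>\<^bsub>Q\<^esub> a) \<in> \<Union>C" if "a \<in> carrier R" for a
    using that G(2) C[OF G(1)] unfolding hom_graph_def by (intro UnionI[OF G(1)]) simp
  fix x' y' assume "(x', y') \<in> \<Union>C"
  then obtain H where H: "H \<in> C" "(x', y') \<in> H" by (elim UnionE)
  obtain K where K: "K \<in> C" "(x, y) \<in> K" "(x', y') \<in> K"
    using chain[OF G(1) H(1)] G H by blast
  then show "(x \<oplus>\<^bsub>M\<^esub> x', y \<oplus>\<^bsub>Q\<^esub> y') \<in> \<Union>C"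
    using C[OF K(1)] unfolding hom_graph_def by (intro UnionI[OF K(1)]) simp
qed

lemma extends_to_of_hom_graph:
  assumes "rmodule R M" "rmodule R Q" and G: "hom_graph R M Q G" "Domain G = carrier M"
    and f: "\<And>x. x \<in> A \<Longrightarrow> (x, f x) \<in> G"
  shows "extends_to R M Q A f"
proof -
  define g where "g x = (THE y. (x, y) \<in> G)" for x
  have g: "g x = y" if "(x, y) \<in> G" for x y
    unfolding g_def using that hom_graph_functional[OF assms(1-3)] by blast
  have gG: "(x, g x) \<in> G" if "x \<in> carrier M" for x
    using that G(2) g by blast
  have "g \<in> rmod_hom R M Q"
  proof (rule rmod_homI)
    fix x assume x: "x \<in> carrier M"
    show "g x \<in> carrier Q"
      using gG[OF x] G unfolding hom_graph_def by blast
    show "g (x \<oplus>\<^bsub>M\<^esub> y) = g x \<oplus>\<^bsub>Q\<^esub> g y" if "y \<in> carrier M" for y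
      by (rule g) (use gG[OF x] gG[OF that] G in \<open>unfold hom_graph_def, blast\<close>)
    show "g (x \<cdot>\<^bsub>M\<^esub> a) = g x \<cdot>\<^bsub>Q\<^esub> a" if "a \<in> carrier R" for a
      by (rule g) (use gG[OF x] that G in \<open>unfold hom_graph_def, blast\<close>)
  qed
  moreover have "g x = f x" if "x \<in> A" for x
    using g f that by blast
  ultimately show ?thesis
    by (auto simp: extends_to_def)
qed

text \<open>The one-element extension step: sending \<open>b\<close> to \<open>c\<close> is
  consistent once \<open>G\<close> already gives multiples of \<open>b\<close> the values dictated
  by \<open>c\<close>.\<close>

lemma hom_graph_adjoin:
  assumes "rmodule R M" "rmodule R Q" and G: "hom_graph R M Q G" "G \<noteq> {}"
    and b: "b \<in> carrier M" and c: "c \<in> carrier Q"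
    and bc: "\<And>r y. r \<in> carrier R \<Longrightarrow> (b \<cdot>\<^bsub>M\<^esub> r, y) \<in> G \<Longrightarrow> y = c \<cdot>\<^bsub>Q\<^esub> r"
  shows "\<exists>G'. hom_graph R M Q G' \<and> G \<subseteq> G' \<and> (b, c) \<in> G'"
proof -
  interpret M: rmodule R M by fact
  interpret Q: rmodule R Q by fact
  have Gc: "x \<in> carrier M" "y \<in> carrier Q" if "(x, y) \<in> G" for x y
    using that G unfolding hom_graph_def by blast+
  have Gadd: "(x \<oplus>\<^bsub>M\<^esub> x', y \<oplus>\<^bsub>Q\<^esub> y') \<in> G" if "(x, y) \<in> G" "(x', y') \<in> G" for x y x' y'
    using that G unfolding hom_graph_def by blast
  have Gact: "(x \<cdot>\<^bsub>M\<^esub> a, y \<cdot>\<^bsub>Q\<^esub> a) \<in> G" if "(x, y) \<in> G" "a \<in> carrier R" for x y a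
    using that G unfolding hom_graph_def by blast
  \<comment> \<open>The sum of \<open>G\<close> and the graph that relates the multiples of
    \<open>b\<close> to those of \<open>c\<close>.\<close>
  define G' where "G' = {(x \<oplus>\<^bsub>M\<^esub> b \<cdot>\<^bsub>M\<^esub> r, y \<oplus>\<^bsub>Q\<^esub> c \<cdot>\<^bsub>Q\<^esub> r) | x y r. (x, y) \<in> G \<and> r \<in> carrier R}"
  have G'I: "(u, v) \<in> G'"
    if "(x, y) \<in> G" "r \<in> carrier R" "u = x \<oplus>\<^bsub>M\<^esub> b \<cdot>\<^bsub>M\<^esub> r" "v = y \<oplus>\<^bsub>Q\<^esub> c \<cdot>\<^bsub>Q\<^esub> r" for u v x y r
    using that unfolding G'_def by blast
  have sub: "G \<subseteq> G'"
  proof (rule subrelI)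
    fix x y assume "(x, y) \<in> G"
    then show "(x, y) \<in> G'"
      by (rule G'I[of _ _ "\<zero>\<^bsub>R\<^esub>"]) (use Gc[OF \<open>(x, y) \<in> G\<close>] b c in auto)
  qed
  have "hom_graph R M Q G'"
    unfolding hom_graph_def
  proof (intro conjI allI impI ballI)
    show "G' \<subseteq> carrier M \<times> carrier Q"
      using Gc b c by (auto simp: G'_def)
    fix x y assume "(x, y) \<in> G'"
    then obtain u v r where r: "(u, v) \<in> G" "r \<in> carrier R"
      "x = u \<oplus>\<^bsub>M\<^esub> b \<cdot>\<^bsub>M\<^esub> r" "y = v \<oplus>\<^bsub>Q\<^esub> c \<cdot>\<^bsub>Q\<^esub> r"
      unfolding G'_def by blast
    { fix x' y' assume "(x', y') \<in> G'"
      then obtain u' v' r' where r': "(u', v') \<in> G" "r' \<in> carrier R"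
        "x' = u' \<oplus>\<^bsub>M\<^esub> b \<cdot>\<^bsub>M\<^esub> r'" "y' = v' \<oplus>\<^bsub>Q\<^esub> c \<cdot>\<^bsub>Q\<^esub> r'"
        unfolding G'_def by blast
      show "(x \<oplus>\<^bsub>M\<^esub> x', y \<oplus>\<^bsub>Q\<^esub> y') \<in> G'"
        by (rule G'I[OF Gadd[OF r(1) r'(1)], of "r \<oplus>\<^bsub>R\<^esub> r'"])
          (use r r' b c Gc in \<open>simp_all add: M.M.ract_add_right Q.M.ract_add_right M.M.a_ac Q.M.a_ac\<close>) }
    { fix a assume a: "a \<in> carrier R"
      show "(x \<cdot>\<^bsub>M\<^esub> a, y \<cdot>\<^bsub>Q\<^esub> a) \<in> G'"
        by (rule G'I[OF Gact[OF r(1) a], of "r \<otimes>\<^bsub>R\<^esub> a"])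
          (use r a b c Gc in \<open>simp_all add: M.M.ract_add_left Q.M.ract_add_left M.M.ract_mult Q.M.ract_mult\<close>) }
  next
    fix y assume "(\<zero>\<^bsub>M\<^esub>, y) \<in> G'"
    then obtain u v r where r: "(u, v) \<in> G" "r \<in> carrier R"
      "\<zero>\<^bsub>M\<^esub> = u \<oplus>\<^bsub>M\<^esub> b \<cdot>\<^bsub>M\<^esub> r" "y = v \<oplus>\<^bsub>Q\<^esub> c \<cdot>\<^bsub>Q\<^esub> r"
      unfolding G'_def by blast
    \<comment> \<open>If \<open>u\<close> plus a multiple of \<open>b\<close> is zero, that multiple
      is the negative of \<open>u\<close> and is related by \<open>G\<close> to the negative of
      \<open>v\<close>. By \<open>bc\<close> the latter is the multiple of \<open>c\<close>, so
      \<open>y\<close> cancels to zero.\<close>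
    let ?m = "\<ominus>\<^bsub>R\<^esub> \<one>\<^bsub>R\<^esub>"
    have uv: "u \<in> carrier M" "v \<in> carrier Q"
      using Gc r(1) by auto
    have "b \<cdot>\<^bsub>M\<^esub> r = u \<cdot>\<^bsub>M\<^esub> ?m"
      using r(2,3) uv b M.M.minus_equality[of "b \<cdot>\<^bsub>M\<^esub> r" u] M.M.a_comm[of u "b \<cdot>\<^bsub>M\<^esub> r"]
      by (simp add: M.ract_uminus_one)
    then have "(b \<cdot>\<^bsub>M\<^esub> r, v \<cdot>\<^bsub>Q\<^esub> ?m) \<in> G"
      using Gact[OF r(1), of ?m] by simp
    then have "v \<cdot>\<^bsub>Q\<^esub> ?m = c \<cdot>\<^bsub>Q\<^esub> r"
      using bc r(2) by blast
    then show "y = \<zero>\<^bsub>Q\<^esub>"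
      using r(4) uv Q.add_ract_uminus_one[of v] by simp
  qed
  moreover have "(b, c) \<in> G'"
  proof -
    \<comment> \<open>Nonemptiness enters here: scaling any pair of \<open>G\<close> by zero yields
      the zero pair, from which \<open>(b, c)\<close> is reached with the scalar one.\<close>
    obtain x y where xy: "(x, y) \<in> G"
      using G(2) by auto
    have "(\<zero>\<^bsub>M\<^esub>, \<zero>\<^bsub>Q\<^esub>) \<in> G"
      using Gact[OF xy, of "\<zero>\<^bsub>R\<^esub>"] Gc[OF xy] by simp
    then show ?thesis
      by (rule G'I[of _ _ "\<one>\<^bsub>R\<^esub>"]) (use b c in \<open>simp_all add: M.M.ract_one Q.M.ract_one\<close>)
  qed
  ultimately show ?thesis
    using sub by blast
qed

text \<open>Zorn's lemma gives a maximal graph \<open>G\<close> containing \<open>f\<close>. Were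
  some \<open>b\<close> outside its domain, the hypothesis on right ideals would supply a consistent
  value for \<open>b\<close>, and adjoining that pair would enlarge \<open>G\<close>.\<close>

lemma Baer_criterion:
  fixes R :: "('a, 'c) ring_scheme" and Q :: "('a, 'n, 'e) rmod_scheme"
    and M :: "('a, 'm, 'd) rmod_scheme"
  assumes "rmodule R Q"
    and baer: "\<And>I f. right_ideal R I \<Longrightarrow> f \<in> rmod_hom R ((regular_rmod R)\<lparr>carrier := I\<rparr>) Q
      \<Longrightarrow> extends_to R (regular_rmod R) Q I f"
    and "rmodule R M" and A: "rsubmodule R M A" and f: "f \<in> rmod_hom R (M\<lparr>carrier := A\<rparr>) Q"
  shows "extends_to R M Q A f"
proof -
  interpret M: rmodule R M by fact
  interpret Q: rmodule R Q by fact
  let ?A = "{G. hom_graph R M Q G \<and> (\<forall>x\<in>A. (x, f x) \<in> G)}"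
  have "\<exists>G\<in>?A. \<forall>X\<in>?A. G \<subseteq> X \<longrightarrow> X = G"
  proof (rule subset_Zorn_nonempty)
    have "f \<zero>\<^bsub>M\<^esub> = \<zero>\<^bsub>Q\<^esub>"
      using rmod_hom_zero[OF rsubmodule_imp_rmodule[OF assms(3) A] assms(1) f] by simp
    then have "hom_graph R M Q ((\<lambda>x. (x, f x)) ` A)"
      using A rmod_hom_closed[OF f] rmod_hom_add[OF f] rmod_hom_ract[OF f]
      unfolding hom_graph_def M.rsubmodule_iff by auto
    then show "?A \<noteq> {}"
      by blast
    fix C assume C: "C \<noteq> {}" "subset.chain ?A C"
    then have "hom_graph R M Q (\<Union>C)"
      unfolding subset_chain_def by (intro hom_graph_Union) blast+
    then show "\<Union>C \<in> ?A"
      using C unfolding subset_chain_def by blast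
  qed
  then obtain G where "G \<in> ?A" and Gmax: "\<forall>X\<in>?A. G \<subseteq> X \<longrightarrow> X = G"
    by (elim bexE)
  then have G: "hom_graph R M Q G" "\<And>x. x \<in> A \<Longrightarrow> (x, f x) \<in> G"
    by simp_all
  have max: "X = G" if "hom_graph R M Q X" "G \<subseteq> X" for X
  proof -
    have "X \<in> ?A"
      using that G(2) by auto
    then show ?thesis
      using Gmax that(2) by simp
  qed
  have Gc: "x \<in> carrier M" "y \<in> carrier Q" if "(x, y) \<in> G" for x y
    using that G(1) unfolding hom_graph_def by blast+
  have Gadd: "(x \<oplus>\<^bsub>M\<^esub> x', y \<oplus>\<^bsub>Q\<^esub> y') \<in> G" if "(x, y) \<in> G" "(x', y') \<in> G" for x y x' y'
    using that G(1) unfolding hom_graph_def by blast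
  have Gact: "(x \<cdot>\<^bsub>M\<^esub> a, y \<cdot>\<^bsub>Q\<^esub> a) \<in> G" if "(x, y) \<in> G" "a \<in> carrier R" for x y a
    using that G(1) unfolding hom_graph_def by blast
  have zero: "(\<zero>\<^bsub>M\<^esub>, \<zero>\<^bsub>Q\<^esub>) \<in> G"
  proof -
    have "(\<zero>\<^bsub>M\<^esub>, f \<zero>\<^bsub>M\<^esub>) \<in> G"
      using G(2) A by (simp add: M.rsubmodule_iff)
    from Gact[OF this M.R.zero_closed] Gc[OF this] show ?thesis by simp
  qed
  have "b \<in> Domain G" if b: "b \<in> carrier M" for b
  proof -
    \<comment> \<open>\<open>L\<close> collects the scalars that carry \<open>b\<close> into the
      domain of \<open>G\<close>, and \<open>\<phi>\<close> reads off the values there. An extension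
      \<open>\<psi>\<close> of \<open>\<phi>\<close> to \<open>R\<close> is determined by
      \<open>\<psi> \<one>\<close>, which becomes the value assigned to \<open>b\<close>.\<close>
    define L where "L = {r \<in> carrier R. b \<cdot>\<^bsub>M\<^esub> r \<in> Domain G}"
    define \<phi> where "\<phi> r = (THE y. (b \<cdot>\<^bsub>M\<^esub> r, y) \<in> G)" for r
    have \<phi>: "\<phi> r = y" if "(b \<cdot>\<^bsub>M\<^esub> r, y) \<in> G" for r y
      unfolding \<phi>_def using that hom_graph_functional[OF assms(3,1) G(1)] by blast
    have \<phi>G: "(b \<cdot>\<^bsub>M\<^esub> r, \<phi> r) \<in> G" if "r \<in> L" for r
      using that \<phi> unfolding L_def by blast
    have add: "(b \<cdot>\<^bsub>M\<^esub> (r \<oplus>\<^bsub>R\<^esub> s), \<phi> r \<oplus>\<^bsub>Q\<^esub> \<phi> s) \<in> G" if "r \<in> L" "s \<in> L" for r s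
      using Gadd[OF \<phi>G[OF that(1)] \<phi>G[OF that(2)]] that b
      by (simp add: L_def M.M.ract_add_right)
    have act: "(b \<cdot>\<^bsub>M\<^esub> (r \<otimes>\<^bsub>R\<^esub> a), \<phi> r \<cdot>\<^bsub>Q\<^esub> a) \<in> G" if "r \<in> L" "a \<in> carrier R" for r a
      using Gact[OF \<phi>G[OF that(1)] that(2)] that b
      by (simp add: L_def M.M.ract_mult)
    have L: "right_ideal R L"
      unfolding M.R.right_ideal_iff
    proof (intro conjI ballI)
      show "\<zero>\<^bsub>R\<^esub> \<in> L"
        using zero b by (auto simp: L_def)
      show "r \<oplus>\<^bsub>R\<^esub> s \<in> L" if "r \<in> L" "s \<in> L" for r s
        using DomainI[OF add[OF that]] that by (simp add: L_def)
      show "r \<otimes>\<^bsub>R\<^esub> a \<in> L" if "r \<in> L" "a \<in> carrier R" for r a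
        using DomainI[OF act[OF that]] that by (simp add: L_def)
    qed (auto simp: L_def)
    have "\<phi> \<in> rmod_hom R ((regular_rmod R)\<lparr>carrier := L\<rparr>) Q"
      by (rule rmod_homI) (use Gc(2)[OF \<phi>G] \<phi>[OF add] \<phi>[OF act] in simp_all)
    then obtain \<psi> where \<psi>: "\<psi> \<in> rmod_hom R (regular_rmod R) Q" "\<And>r. r \<in> L \<Longrightarrow> \<psi> r = \<phi> r"
      using baer[OF L] unfolding extends_to_def by blast
    have one: "\<psi> \<one>\<^bsub>R\<^esub> \<in> carrier Q"
      using rmod_hom_closed[OF \<psi>(1), of "\<one>\<^bsub>R\<^esub>"] by simp
    have "y = \<psi> \<one>\<^bsub>R\<^esub> \<cdot>\<^bsub>Q\<^esub> r" if r: "r \<in> carrier R" "(b \<cdot>\<^bsub>M\<^esub> r, y) \<in> G" for r y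
    proof -
      have "r \<in> L"
        using r by (auto simp: L_def)
      then have "y = \<psi> r"
        using \<phi>[OF r(2)] \<psi>(2) by simp
      also have "\<dots> = \<psi> \<one>\<^bsub>R\<^esub> \<cdot>\<^bsub>Q\<^esub> r"
        using rmod_hom_ract[OF \<psi>(1), of "\<one>\<^bsub>R\<^esub>" r] r by simp
      finally show ?thesis .
    qed
    then obtain G' where "hom_graph R M Q G'" "G \<subseteq> G'" "(b, \<psi> \<one>\<^bsub>R\<^esub>) \<in> G'"
      using hom_graph_adjoin[OF assms(3,1) G(1) _ b one] zero by blast
    then show ?thesis
      using max by blast
  qed
  then have "Domain G = carrier M"
    using Gc(1) by blast
  then show ?thesis
    by (rule extends_to_of_hom_graph[OF assms(3,1) G(1) _ G(2)])
qed

text \<open>The regular module moved along \<open>Inl\<close> into the sum type used for test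
  modules in \<open>right_self_injective\<close>. Only elements of the form \<open>Inl x\<close> are
  in the carrier, so the values of \<open>projl\<close> elsewhere are irrelevant.\<close>

definition sum_copy :: "('a, 'c) ring_scheme \<Rightarrow> ('a, 'a + 'b) rmod" where
  "sum_copy R = \<lparr>carrier = Inl ` carrier R, mult = undefined, one = undefined, zero = Inl \<zero>\<^bsub>R\<^esub>,
     add = (\<lambda>x y. Inl (projl x \<oplus>\<^bsub>R\<^esub> projl y)), ract = (\<lambda>x a. Inl (projl x \<otimes>\<^bsub>R\<^esub> a))\<rparr>"

lemma sum_copy_sel [simp]:
  "carrier (sum_copy R) = Inl ` carrier R" "zero (sum_copy R) = Inl \<zero>\<^bsub>R\<^esub>"
  "x \<oplus>\<^bsub>sum_copy R\<^esub> y = Inl (projl x \<oplus>\<^bsub>R\<^esub> projl y)"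
  "x \<cdot>\<^bsub>sum_copy R\<^esub> a = Inl (projl x \<otimes>\<^bsub>R\<^esub> a)"
  by (simp_all add: sum_copy_def)

lemma (in ring) sum_copy_rmodule: "rmodule R (sum_copy R :: ('a, 'a + 'c) rmod)"
proof -
  let ?M = "sum_copy R :: ('a, 'a + 'c) rmod"
  have "abelian_group ?M"
  proof (rule abelian_groupI)
    fix x assume "x \<in> carrier ?M"
    then show "\<exists>y\<in>carrier ?M. y \<oplus>\<^bsub>?M\<^esub> x = \<zero>\<^bsub>?M\<^esub>"
      by (intro bexI[of _ "Inl (\<ominus> projl x)"]) (auto simp: l_neg)
  qed (auto simp: a_ac)
  then show ?thesis
    unfolding rmodule_iff right_module_def right_module_axioms_def
    using ring_axioms by (auto simp: l_distr r_distr m_assoc)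
qed

text \<open>From right to left this is Baer's criterion. The other direction tests injectivity on
  \<open>sum_copy R\<close> and carries the extension back by composing with
  \<open>Inl\<close>.\<close>

lemma (in ring) right_self_injective_iff:
  "right_self_injective TYPE('a + 'c) R \<longleftrightarrow>
     (\<forall>I f. right_ideal R I \<longrightarrow> f \<in> rmod_hom R ((regular_rmod R)\<lparr>carrier := I\<rparr>) (regular_rmod R)
        \<longrightarrow> extends_to R (regular_rmod R) (regular_rmod R) I f)" (is "?L \<longleftrightarrow> ?R")
proof
  assume ?R
  then show ?L
    unfolding right_self_injective_def injective_rmod_def
    using regular_rmodule Baer_criterion[OF regular_rmodule] unfolding rmodule_iff by blast
next
  assume L: ?L
  let ?M = "sum_copy R :: ('a, 'a + 'c) rmod"
  interpret M: rmodule R ?M by (rule sum_copy_rmodule)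
  show ?R
  proof (intro allI impI)
    fix I f
    assume I: "right_ideal R I"
      and f: "f \<in> rmod_hom R ((regular_rmod R)\<lparr>carrier := I\<rparr>) (regular_rmod R)"
    have "rsubmodule R ?M (Inl ` I)"
      using I by (auto simp: M.rsubmodule_iff right_ideal_iff)
    moreover have "f \<circ> projl \<in> rmod_hom R (?M\<lparr>carrier := Inl ` I\<rparr>) (regular_rmod R)"
      by (rule rmod_homI)
        (use rmod_hom_closed[OF f] rmod_hom_add[OF f] rmod_hom_ract[OF f] in auto)
    ultimately have "extends_to R ?M (regular_rmod R) (Inl ` I) (f \<circ> projl)"
      using L M.M.right_module_axioms
      unfolding right_self_injective_def injective_rmod_def by blast
    then obtain g where g: "g \<in> rmod_hom R ?M (regular_rmod R)" "\<And>x. x \<in> I \<Longrightarrow> g (Inl x) = f x"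
      by (auto simp: extends_to_def)
    have "g \<circ> Inl \<in> rmod_hom R (regular_rmod R) (regular_rmod R)"
    proof (rule rmod_homI)
      fix x assume x: "x \<in> carrier (regular_rmod R)"
      then have Mx: "Inl x \<in> carrier ?M" by simp
      show "(g \<circ> Inl) x \<in> carrier (regular_rmod R)"
        using rmod_hom_closed[OF g(1) Mx] by simp
      show "(g \<circ> Inl) (x \<oplus>\<^bsub>regular_rmod R\<^esub> y) = (g \<circ> Inl) x \<oplus>\<^bsub>regular_rmod R\<^esub> (g \<circ> Inl) y"
        if "y \<in> carrier (regular_rmod R)" for y
        using rmod_hom_add[OF g(1) Mx, of "Inl y"] that by simp
      show "(g \<circ> Inl) (x \<cdot>\<^bsub>regular_rmod R\<^esub> a) = (g \<circ> Inl) x \<cdot>\<^bsub>regular_rmod R\<^esub> a"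
        if "a \<in> carrier R" for a
        using rmod_hom_ract[OF g(1) Mx that] by simp
    qed
    then show "extends_to R (regular_rmod R) (regular_rmod R) I f"
      unfolding extends_to_def by (rule bexI[rotated]) (simp add: g(2))
  qed
qed

section \<open>Reduction of the injectivity conditions to the radical\<close>

lemma extends_to_zero:
  assumes "rmodule R M" "rmodule R Q" "\<And>x. x \<in> N \<Longrightarrow> f x = \<zero>\<^bsub>Q\<^esub>"
  shows "extends_to R M Q N f"
  unfolding extends_to_def
proof (rule bexI[of _ "\<lambda>_. \<zero>\<^bsub>Q\<^esub>"])
  interpret M: rmodule R M by fact
  interpret Q: rmodule R Q by fact
  show "(\<lambda>_. \<zero>\<^bsub>Q\<^esub>) \<in> rmod_hom R M Q"
    by (rule rmod_homI) auto
qed (use assms(3) in auto)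

section \<open>Columns and their entries\<close>

lemma (in ring) column_rmodule: "rmodule R (column_rmod R n)"
proof -
  have "abelian_group (column_rmod R n)"
  proof (rule abelian_groupI)
    fix x assume "x \<in> carrier (column_rmod R n)"
    then show "\<exists>y\<in>carrier (column_rmod R n). y \<oplus>\<^bsub>column_rmod R n\<^esub> x = \<zero>\<^bsub>column_rmod R n\<^esub>"
      by (intro bexI[of _ "\<lambda>i\<in>{..<n}. \<ominus> x i"])
        (auto simp: column_rmod_def PiE_def Pi_def restrict_def l_neg extensional_def)
  qed (auto simp: column_rmod_def PiE_def Pi_def restrict_def a_ac extensional_def)
  then show ?thesis
    unfolding rmodule_iff right_module_def right_module_axioms_def
    using ring_axioms
    by (auto simp: column_rmod_def PiE_def Pi_def restrict_def l_distr r_distr m_assoc extensional_def)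
qed

lemma (in ring) column_entry_hom:
  assumes "i < n"
  shows "(\<lambda>x. x i) \<in> rmod_hom R (column_rmod R n) (regular_rmod R)"
  by (rule rmod_homI) (use assms in \<open>auto simp: column_rmod_def\<close>)

context ring
begin

interpretation reg: rmodule R "regular_rmod R"
  by (rule regular_rmodule)

lemma id_hom: "(\<lambda>x. x) \<in> rmod_hom R RR RR"
  by (rule rmod_homI) auto

text \<open>Deflation for the regular module with the identity as linear form. The map
  \<open>p\<close> is returned as a homomorphism of \<open>R\<close>, so that generators and images
  can be followed through it.\<close>

lemma extends_to_via_radical:
  assumes U: "right_ideal R U" and e: "e \<in> U" "\<And>u. u \<in> U \<Longrightarrow> u \<ominus> e \<otimes> u \<in> J"
    and f: "f \<in> rmod_hom R (RR\<lparr>carrier := U\<rparr>) RR"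
  obtains p where "p \<in> rmod_hom R RR RR" "right_ideal R (p ` U)" "p ` U \<subseteq> U" "p ` U \<subseteq> J"
    "extends_to R RR RR (p ` U) f \<Longrightarrow> extends_to R RR RR U f"
proof
  let ?p = "reg.deflate (\<lambda>x. x) e"
  have Us: "rsubmodule R RR U"
    using U by (simp add: right_ideal_def)
  have Uc: "u \<in> carrier RR" if "u \<in> U" for u
    using that U by (auto simp: right_ideal_iff)
  show p: "?p \<in> rmod_hom R RR RR"
    by (rule reg.deflate_hom[OF id_hom Uc[OF e(1)]])
  have "?p \<in> rmod_hom R (RR\<lparr>carrier := carrier RR\<rparr>) RR"
    using p by (simp add: rmod_hom_def)
  from rmod_hom_restrict[OF this, of U] have "?p \<in> rmod_hom R (RR\<lparr>carrier := U\<rparr>) RR"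
    using Uc by blast
  from rsubmodule_image[OF regular_rmodule regular_rmodule Us this]
  show "right_ideal R (?p ` U)"
    by (simp add: right_ideal_def)
  show "?p ` U \<subseteq> U"
    using reg.deflate_in[OF id_hom Us e(1)] by blast
  show "?p ` U \<subseteq> J"
    using reg.hom_deflate[OF id_hom Uc[OF e(1)] Uc] e(2) by auto
  show "extends_to R RR RR U f" if "extends_to R RR RR (?p ` U) f"
    by (rule reg.extends_to_deflate[OF id_hom Us e(1) f that])
qed

lemma small_injective_imp_extends:
  assumes "semilocal R" "right_small_injective R"
    and U: "right_ideal R U" and f: "f \<in> rmod_hom R (RR\<lparr>carrier := U\<rparr>) RR"
  shows "extends_to R RR RR U f"
proof -
  obtain e where e: "e \<in> U" "\<And>u. u \<in> U \<Longrightarrow> u \<ominus> e \<otimes> u \<in> J"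
    using left_unit_modulo_radical_artinian[OF _ U] assms(1)
    unfolding semilocal_def semisimple_artinian_def by blast
  obtain p where p: "right_ideal R (p ` U)" "p ` U \<subseteq> U" "p ` U \<subseteq> J"
    and ext: "extends_to R RR RR (p ` U) f \<Longrightarrow> extends_to R RR RR U f"
    using extends_to_via_radical[OF U e f] by metis
  show ?thesis
    using ext assms(2) small_right_idealI[OF p(1,3)] rmod_hom_restrict[OF f p(2)]
    unfolding right_small_injective_def by blast
qed

text \<open>Restricting \<open>f\<close> to the image of \<open>U\<close> under \<open>p\<close>
  leaves a submodule of a simple module as its range. Either that range is zero and the zero map
  extends the restriction, or it is still the simple image and the hypothesis applies.\<close>

lemma simple_J_injective_imp_simple_injective:
  assumes "semilocal R" and inj: "right_simple_J_injective R"
  shows "right_simple_injective R"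
  unfolding right_simple_injective_def
proof (intro allI impI, elim conjE)
  fix U f
  assume U: "right_ideal R U" and f: "f \<in> rmod_hom R (RR\<lparr>carrier := U\<rparr>) RR"
    and simple: "simple_rsubmodule R RR (f ` U)"
  obtain e where e: "e \<in> U" "\<And>u. u \<in> U \<Longrightarrow> u \<ominus> e \<otimes> u \<in> J"
    using left_unit_modulo_radical_artinian[OF _ U] assms(1)
    unfolding semilocal_def semisimple_artinian_def by blast
  obtain p where p: "right_ideal R (p ` U)" "p ` U \<subseteq> U" "p ` U \<subseteq> J"
    and ext: "extends_to R RR RR (p ` U) f \<Longrightarrow> extends_to R RR RR U f"
    using extends_to_via_radical[OF U e f] by metis
  note f' = rmod_hom_restrict[OF f p(2)]
  have "rsubmodule R RR (f ` p ` U)"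
    using rsubmodule_image[OF regular_rmodule regular_rmodule _ f'] p(1) by (simp add: right_ideal_def)
  moreover have "f ` p ` U \<subseteq> f ` U"
    using p(2) by blast
  ultimately consider "f ` p ` U = {\<zero>\<^bsub>RR\<^esub>}" | "f ` p ` U = f ` U"
    using simple unfolding simple_rsubmodule_def by blast
  then have "extends_to R RR RR (p ` U) f"
  proof cases
    case 1
    then show ?thesis
      by (intro extends_to_zero[OF regular_rmodule regular_rmodule]) blast
  next
    case 2
    then show ?thesis
      using inj simple small_right_idealI[OF p(1,3)] f'
      unfolding right_simple_J_injective_def by metis
  qed
  then show "extends_to R RR RR U f"
    by (rule ext)
qed

text \<open>The images under \<open>p\<close> of \<open>m\<close> generators of \<open>U\<close>
  generate the image of \<open>U\<close>, and the restricted \<open>f\<close> still takes its values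
  in \<open>K\<close>. So the hypothesis applies with the same \<open>m\<close> and
  \<open>K\<close>.\<close>

lemma IK_m_injective_radical_imp:
  assumes vnr: "von_neumann_regular (R Quot J)" and inj: "right_IK_m_injective R J K m"
    and K: "K \<subseteq> carrier R"
  shows "right_IK_m_injective R (carrier R) K m"
  unfolding right_IK_m_injective_def
proof (intro allI impI, elim conjE)
  fix U f
  assume U: "right_ideal R U" and gen: "m_generated R RR m U"
    and f: "f \<in> rmod_hom R (RR\<lparr>carrier := U\<rparr>) (RR\<lparr>carrier := K\<rparr>)"
  obtain x where x: "x ` {..<m} \<subseteq> carrier R" "U = rspan R RR (x ` {..<m})"
    using gen by (auto simp: m_generated_def)
  obtain e where e: "e \<in> U" "\<And>u. u \<in> U \<Longrightarrow> u \<ominus> e \<otimes> u \<in> J"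
    using left_unit_modulo_radical_regular[OF vnr _ x(1)] x(2) by auto
  have fR: "f \<in> rmod_hom R (RR\<lparr>carrier := U\<rparr>) RR"
    using rmod_hom_codomain_mono[OF f] K by simp
  obtain p where p: "p \<in> rmod_hom R RR RR" "right_ideal R (p ` U)" "p ` U \<subseteq> U" "p ` U \<subseteq> J"
    and ext: "extends_to R RR RR (p ` U) f \<Longrightarrow> extends_to R RR RR U f"
    using extends_to_via_radical[OF U e fR] by metis
  have "p ` U = rspan R RR ((p \<circ> x) ` {..<m})"
    using rspan_image[OF regular_rmodule regular_rmodule p(1)] x by (simp add: image_comp)
  moreover have "(p \<circ> x) ` {..<m} \<subseteq> carrier RR"
    using rmod_hom_closed[OF p(1)] x(1) by auto
  ultimately have "m_generated R RR m (p ` U)"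
    unfolding m_generated_def by blast
  then show "extends_to R RR RR U f"
    using ext inj p(2,4) rmod_hom_restrict[OF f p(3)]
    unfolding right_IK_m_injective_def by blast
qed

lemma IK_m_injective_antimono:
  "right_IK_m_injective R I K m \<Longrightarrow> I' \<subseteq> I \<Longrightarrow> right_IK_m_injective R I' K m"
  unfolding right_IK_m_injective_def by blast

lemma IK_m_injective_radical_iff:
  assumes "semiregular R" "K \<subseteq> carrier R"
  shows "right_IK_m_injective R J K m \<longleftrightarrow> right_IK_m_injective R (carrier R) K m"
  using IK_m_injective_radical_imp[OF _ _ assms(2)] assms(1) radical_subset_carrier
    IK_m_injective_antimono
  unfolding semiregular_def by blast

lemma m_injective_iff: "right_m_injective R m \<longleftrightarrow> right_IK_m_injective R (carrier R) (carrier R) m"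
proof -
  have "RR\<lparr>carrier := carrier R\<rparr> = RR"
    by (simp add: regular_rmod_def)
  moreover have "U \<subseteq> carrier R" if "right_ideal R U" for U
    using that by (simp add: right_ideal_iff)
  ultimately show ?thesis
    unfolding right_m_injective_def right_IK_m_injective_def by (metis (no_types, lifting))
qed

lemma F_injective_iff: "right_F_injective R \<longleftrightarrow> (\<forall>k\<ge>1. right_m_injective R k)"
proof
  assume "right_F_injective R"
  then show "\<forall>k\<ge>1. right_m_injective R k"
    using reg.m_generated_imp_fin_generated
    unfolding right_F_injective_def right_m_injective_def by blast
next
  assume inj: "\<forall>k\<ge>1. right_m_injective R k"
  show "right_F_injective R"
    unfolding right_F_injective_def
  proof (intro allI impI, elim conjE)
    fix U f
    assume U: "right_ideal R U" "fin_generated R RR U" "f \<in> rmod_hom R (RR\<lparr>carrier := U\<rparr>) RR"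
    then obtain k where "k \<ge> 1" "m_generated R RR k U"
      using reg.fin_generated_imp_m_generated by blast
    then show "extends_to R RR RR U f"
      using U inj unfolding right_m_injective_def by blast
  qed
qed

text \<open>The entries of the columns are moved into \<open>J\<close> one coordinate at a time.\<close>

lemma FP_extends:
  assumes vnr: "von_neumann_regular (R Quot J)" and inj: "right_IK_FP_injective R J (carrier R)"
    and "n \<ge> 1" "k \<le> n"
    and S: "finite S" "S \<subseteq> carrier (column_rmod R n)"
    and "\<And>x i. x \<in> rspan R (column_rmod R n) S \<Longrightarrow> k \<le> i \<Longrightarrow> i < n \<Longrightarrow> x i \<in> J"
    and "f \<in> rmod_hom R ((column_rmod R n)\<lparr>carrier := rspan R (column_rmod R n) S\<rparr>) RR"
  shows "extends_to R (column_rmod R n) RR (rspan R (column_rmod R n) S) f"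
  using assms(4-)
\<comment> \<open>The columns may have entries outside \<open>J\<close> only at indices below
  \<open>k\<close>. The generators change from step to step, while \<open>f\<close> stays fixed
  because it is only restricted to smaller submodules.\<close>
proof (induction k arbitrary: S)
  case 0
  let ?M = "column_rmod R n"
  interpret M: rmodule R ?M by (rule column_rmodule)
  let ?N = "rspan R ?M S"
  have N: "rsubmodule R ?M ?N"
    using M.rsubmodule_rspan 0 by blast
  have "x \<in> {..<n} \<rightarrow>\<^sub>E J" if x: "x \<in> ?N" for x
  proof -
    have "x \<in> {..<n} \<rightarrow>\<^sub>E carrier R"
      using x N unfolding M.rsubmodule_iff by (auto simp: column_rmod_def)
    then show ?thesis
      using 0(4)[OF x] by (auto simp: PiE_iff)
  qed
  moreover have "fin_generated R ?M ?N"
    using 0 unfolding fin_generated_def by blast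
  moreover have "f \<in> rmod_hom R (?M\<lparr>carrier := ?N\<rparr>) (RR\<lparr>carrier := carrier R\<rparr>)"
    using 0(5) by (simp add: rmod_hom_def)
  ultimately show ?case
    using inj N \<open>n \<ge> 1\<close> unfolding right_IK_FP_injective_def by blast
next
  case (Suc k)
  let ?M = "column_rmod R n"
  interpret M: rmodule R ?M by (rule column_rmodule)
  let ?N = "rspan R ?M S" and ?\<phi> = "\<lambda>x. x k"
  have N: "rsubmodule R ?M ?N"
    using M.rsubmodule_rspan Suc.prems by blast
  have \<phi>: "?\<phi> \<in> rmod_hom R ?M RR"
    using column_entry_hom Suc.prems by simp
  have Nc: "x \<in> carrier ?M" if "x \<in> ?N" for x
    using that N by (auto simp: M.rsubmodule_iff)
  have \<phi>N: "?\<phi> ` ?N = rspan R RR (?\<phi> ` S)"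
    by (rule rspan_image[OF column_rmodule regular_rmodule \<phi> Suc.prems(3)])
  have "?\<phi> ` S \<subseteq> carrier R"
    using rmod_hom_closed[OF \<phi>] Suc.prems(3) by auto
  \<comment> \<open>The entries at index \<open>k\<close> form a finitely generated right ideal, so
    it has a left unit \<open>e\<close> modulo \<open>J\<close>; as a member of that ideal,
    \<open>e\<close> is the entry of some column \<open>y\<close> in \<open>?N\<close>.\<close>
  then obtain e where e: "e \<in> ?\<phi> ` ?N" "\<And>u. u \<in> ?\<phi> ` ?N \<Longrightarrow> u \<ominus> e \<otimes> u \<in> J"
    using left_unit_modulo_radical_regular[OF vnr, of "?\<phi> ` S"] Suc.prems(2) unfolding \<phi>N by blast
  obtain y where y: "y \<in> ?N" "e = y k"
    using e(1) by blast
  let ?p = "M.deflate ?\<phi> y"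
  have p: "?p \<in> rmod_hom R ?M ?M"
    by (rule M.deflate_hom[OF \<phi> Nc[OF y(1)]])
  have pN: "?p ` ?N = rspan R ?M (?p ` S)"
    by (rule rspan_image[OF column_rmodule column_rmodule p Suc.prems(3)])
  have sub: "?p ` ?N \<subseteq> ?N"
    using M.deflate_in[OF \<phi> N y(1)] by blast
  have "extends_to R ?M RR (rspan R ?M (?p ` S)) f"
  proof (rule Suc.IH)
    show "k \<le> n" "finite (?p ` S)"
      using Suc.prems by auto
    show "?p ` S \<subseteq> carrier ?M"
      using rmod_hom_closed[OF p] Suc.prems(3) by blast
    show "f \<in> rmod_hom R (?M\<lparr>carrier := rspan R ?M (?p ` S)\<rparr>) RR"
      using rmod_hom_restrict[OF Suc.prems(5) sub] unfolding pN .
    fix x i assume x: "x \<in> rspan R ?M (?p ` S)" and i: "k \<le> i" "i < n"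
    obtain z where z: "z \<in> ?N" "x = ?p z"
      using x unfolding pN[symmetric] by blast
    show "x i \<in> J"
    \<comment> \<open>Entry \<open>k\<close> falls into \<open>J\<close> by the choice of
      \<open>e\<close>. Larger entries remain in \<open>J\<close> because the deflated column still
      belongs to \<open>?N\<close>.\<close>
    proof (cases "i = k")
      case True
      then show ?thesis
        using M.hom_deflate[OF \<phi> Nc[OF y(1)] Nc[OF z(1)]] e(2)[of "z k"] z y by simp
    next
      case False
      then show ?thesis
        using Suc.prems(4)[of x i] i sub z by auto
    qed
  qed
  then show ?case
    using M.extends_to_deflate[OF \<phi> N y(1) Suc.prems(5)] unfolding pN by blast
qed

lemma FP_injective_radical_iff:
  assumes "semiregular R"
  shows "right_IK_FP_injective R J (carrier R) \<longleftrightarrow> right_FP_injective R"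
proof
  assume inj: "right_IK_FP_injective R J (carrier R)"
  have vnr: "von_neumann_regular (R Quot J)"
    using assms by (simp add: semiregular_def)
  show "right_FP_injective R"
    unfolding right_FP_injective_def right_IK_FP_injective_def
  proof (intro allI impI, elim conjE)
    fix n :: nat and N f
    assume n: "1 \<le> n" and N: "fin_generated R (column_rmod R n) N"
      and f: "f \<in> rmod_hom R ((column_rmod R n)\<lparr>carrier := N\<rparr>) (RR\<lparr>carrier := carrier R\<rparr>)"
    obtain S where S: "finite S" "S \<subseteq> carrier (column_rmod R n)" "N = rspan R (column_rmod R n) S"
      using N unfolding fin_generated_def by blast
    have fN: "f \<in> rmod_hom R ((column_rmod R n)\<lparr>carrier := N\<rparr>) RR"
      using f by (simp add: rmod_hom_def)
    \<comment> \<open>Starting the induction at \<open>k = n\<close> makes the condition on entries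
      vacuous.\<close>
    show "extends_to R (column_rmod R n) RR N f"
      using FP_extends[OF vnr inj n order_refl S(1,2) _ fN[unfolded S(3)]] unfolding S(3) by simp
  qed
next
  assume "right_FP_injective R"
  moreover have "({..<n} \<rightarrow>\<^sub>E J) \<subseteq> ({..<n} \<rightarrow>\<^sub>E carrier R)" for n :: nat
    by (rule PiE_mono) (rule radical_subset_carrier)
  ultimately show "right_IK_FP_injective R J (carrier R)"
    unfolding right_FP_injective_def right_IK_FP_injective_def by (meson order_trans)
qed

lemma socle_subset_carrier: "right_socle R \<subseteq> carrier R"
  unfolding right_socle_def
  by (rule reg.rspan_subset[OF reg.rsubmodule_carrier, simplified])
    (auto simp: simple_rsubmodule_def reg.rsubmodule_iff)

end

theorem theorem3p4:
  fixes R :: "('a, 'c) ring_scheme"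
  assumes "ring R"
  shows
    "(semilocal R \<longrightarrow>
        (right_self_injective TYPE('a + 'b) R \<longleftrightarrow> right_small_injective R)) \<and>
     (semilocal R \<longrightarrow>
        (right_simple_injective R \<longleftrightarrow> right_simple_J_injective R)) \<and>
     (semiregular R \<longrightarrow>
        (\<forall>I m. right_ideal R I \<and> m \<ge> 1 \<longrightarrow>
           (right_IK_m_injective R (jacobson_radical R) I m
             \<longleftrightarrow> right_IK_m_injective R (carrier R) I m)) \<and>
        (\<forall>m\<ge>1. right_IK_m_injective R (jacobson_radical R) (right_socle R) m
             \<longleftrightarrow> right_IK_m_injective R (carrier R) (right_socle R) m) \<and>
        (\<forall>m\<ge>1. right_IK_m_injective R (jacobson_radical R) (carrier R) m
             \<longleftrightarrow> right_m_injective R m) \<and>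
        (right_F_injective R
             \<longleftrightarrow> (\<forall>k\<ge>1. right_IK_m_injective R (jacobson_radical R) (carrier R) k))) \<and>
     (semiregular R \<longrightarrow>
        (right_IK_FP_injective R (jacobson_radical R) (carrier R) \<longleftrightarrow> right_FP_injective R))"
proof -
  interpret ring R by fact
  \<comment> \<open>Small right ideals are right ideals, so one direction is a restriction of the
    condition. The same holds for simple injectivity.\<close>
  have 1: "right_self_injective TYPE('a + 'b) R \<longleftrightarrow> right_small_injective R" if "semilocal R"
    unfolding right_self_injective_iff
    using small_injective_imp_extends[OF that]
    unfolding right_small_injective_def small_right_ideal_def by blast
  have 2: "right_simple_injective R \<longleftrightarrow> right_simple_J_injective R" if "semilocal R"
    using simple_J_injective_imp_simple_injective[OF that]
    unfolding right_simple_injective_def right_simple_J_injective_def small_right_ideal_def by blast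
  have 3: "right_IK_m_injective R (jacobson_radical R) I m \<longleftrightarrow> right_IK_m_injective R (carrier R) I m"
    if "semiregular R" "right_ideal R I" for I m
    using IK_m_injective_radical_iff[OF that(1)] that(2) by (simp add: right_ideal_iff)
  show ?thesis
    using 1 2 3 IK_m_injective_radical_iff socle_subset_carrier m_injective_iff F_injective_iff
      FP_injective_radical_iff by simp
qed

end
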